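(* For every $w\in\mathfrak{H}^0$, $$\zeta^{\mathrm{OOZ}}(w)=\zeta^{\mathrm{OOZ}}\big(V^{-1}\circ\widetilde\tau\circ V(w)\big).$$ If moreover $w\in\mathfrak{h}^0$, then also $$\zeta^{\mathrm{OOZ}}(w)=\zeta^{\mathrm{OOZ}}\big(U^{-1}\circ\tau\circ U(w)\big).$$
   Context: Let $\mathfrak{H}=\mathbb{Q}\langle p,y\rangle$, $z_k:=p^ky$ ($k\ge0$), $\mathfrak{H}^0=\mathbb{Q}\mathbf{1}\oplus p\mathfrak{H}y$ (spanned by $\mathbf{1}$ and $z_{k_1}\cdots z_{k_n}$ with $k_1\ge1$, $k_j\ge0$). Identify $x_0=p$ and $x_1=py$, so $\mathfrak{h}=\mathbb{Q}\langle x_0,x_1\rangle\subset\mathfrak{H}$ and $z_k=x_0^{k-1}x_1$ for $k\ge1$; let $\mathfrak{h}^0=\mathbb{Q}\mathbf{1}\oplus x_0\mathfrak{h}x_1$, spanned by $\mathbf{1}$ and $z_{k_1}\cdots z_{k_n}$ with $k_1\ge2$, $k_j\ge1$. Let $\widetilde\tau$ be the anti-automorphism of $\mathfrak{H}$ with $\widetilde\tau(p)=y$, $\widetilde\tau(y)=p$ (preserves $\mathfrak{H}^0$), and $\tau$ the anti-automorphism of $\mathfrak{h}$ with $\tau(x_0)=x_1$, $\tau(x_1)=x_0$ (preserves $\mathfrak{h}^0$). Define $U\colon\mathfrak{h}^0\to\mathfrak{h}^0$ and $V\colon\mathfrak{H}^0\to\mathfrak{H}^0$ linearly by $U(\mathbf{1})=V(\mathbf{1})=\mathbf{1}$,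 $U(z_{k_1}\cdots z_{k_n})=\sum_{2\le r_1\le k_1,\ 1\le r_j\le k_j\,(j\ge2)}\binom{k_1-2}{r_1-2}\prod_{j\ge2}\binom{k_j-1}{r_j-1}z_{r_1}\cdots z_{r_n}$, $V(z_{k_1}\cdots z_{k_n})=\sum_{1\le r_1\le k_1,\ 0\le r_j\le k_j\,(j\ge2)}\binom{k_1-1}{r_1-1}\prod_{j\ge2}\binom{k_j}{r_j}z_{r_1}\cdots z_{r_n}$; these are linear isomorphisms. The map $\zeta^{\mathrm{OOZ}}\colon\mathfrak{H}^0\to\mathbb{Q}[[q]]$ is linear with $\zeta^{\mathrm{OOZ}}(\mathbf{1})=1$ and $\zeta^{\mathrm{OOZ}}(z_{k_1}\cdots z_{k_n})=\sum_{m_1>\cdots>m_n>0}\frac{q^{m_1}}{(1-q^{m_1})^{k_1}\cdots(1-q^{m_n})^{k_n}}$. *)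

theory Defs
  imports "HOL-Analysis.Analysis" "HOL-Library.Poly_Mapping"
begin

section \<open>The free algebra on two letters\<close>

datatype letter = LP | LY

text \<open>Words form a monoid under concatenation, written additively because the
  convolution product of \<^theory>\<open>HOL-Library.Poly_Mapping\<close> is indexed by an additive
  (here non-commutative) monoid.\<close>

datatype word = Word (letters: "letter list")

instantiation word :: monoid_add
begin

definition zero_word :: word where "0 = Word []"

definition plus_word :: "word \<Rightarrow> word \<Rightarrow> word" where
  "u + v = Word (letters u @ letters v)"

instance
  by standard (auto simp: zero_word_def plus_word_def)

end

text \<open>\<open>ncpoly\<close> is the monoid algebra over the rationals of the free monoid on \<open>p\<close>, \<open>y\<close>,
  with its ring structure taken from \<^theory>\<open>HOL-Library.Poly_Mapping\<close>.\<close>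

type_synonym ncpoly = "word \<Rightarrow>\<^sub>0 rat"

definition const :: "rat \<Rightarrow> ncpoly" where
  "const c = Poly_Mapping.single 0 c"

definition monomial :: "letter list \<Rightarrow> ncpoly" where
  "monomial u = Poly_Mapping.single (Word u) 1"

definition p :: ncpoly where "p = monomial [LP]"

definition y :: ncpoly where "y = monomial [LY]"

definition z :: "nat \<Rightarrow> ncpoly" where "z k = p ^ k * y"

definition zprod :: "nat list \<Rightarrow> ncpoly" where
  "zprod ks = prod_list (map z ks)"

definition H0 :: "ncpoly set" where
  "H0 = {const c + p * a * y | c a. True}"

definition x0 :: ncpoly where "x0 = p"

definition x1 :: ncpoly where "x1 = p * y"

text \<open>The subalgebra generated by \<open>x0\<close> and \<open>x1\<close>; these generate it freely.\<close>

inductive_set hh :: "ncpoly set" where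
  const: "const c \<in> hh"
| x0: "x0 \<in> hh"
| x1: "x1 \<in> hh"
| add: "a \<in> hh \<Longrightarrow> b \<in> hh \<Longrightarrow> a + b \<in> hh"
| mult: "a \<in> hh \<Longrightarrow> b \<in> hh \<Longrightarrow> a * b \<in> hh"

definition h0 :: "ncpoly set" where
  "h0 = {const c + x0 * a * x1 | c a. a \<in> hh}"

text \<open>Linear extension of a function on words to a rational algebra \<open>'b\<close>, where \<open>e\<close> is the
  embedding of the rationals into \<open>'b\<close>.\<close>

definition lin_ext :: "(rat \<Rightarrow> 'b) \<Rightarrow> (letter list \<Rightarrow> 'b::ring_1) \<Rightarrow> ncpoly \<Rightarrow> 'b" where
  "lin_ext e f a = (\<Sum>u\<in>Poly_Mapping.keys a. e (Poly_Mapping.lookup a u) * f (letters u))"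

section \<open>The two dualities\<close>

fun swap_letter :: "letter \<Rightarrow> letter" where
  "swap_letter LP = LY"
| "swap_letter LY = LP"

definition tau_tilde :: "ncpoly \<Rightarrow> ncpoly" where
  "tau_tilde = lin_ext const (\<lambda>u. monomial (rev (map swap_letter u)))"

text \<open>A word lies in \<open>hh\<close> iff each \<open>LY\<close> is immediately preceded by \<open>LP\<close>; it is then parsed
  uniquely into blocks \<open>x1 = LP LY\<close> and \<open>x0 = LP\<close>, which are exchanged while the order of
  the blocks is reversed. The last equation concerns words outside \<open>hh\<close> and is irrelevant.\<close>

fun tau_word :: "letter list \<Rightarrow> letter list" where
  "tau_word [] = []"
| "tau_word (LP # LY # u) = tau_word u @ [LP]"
| "tau_word (LP # u) = tau_word u @ [LP, LY]"
| "tau_word (LY # u) = tau_word u"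

definition tau :: "ncpoly \<Rightarrow> ncpoly" where
  "tau = lin_ext const (\<lambda>u. monomial (tau_word u))"

section \<open>The maps U and V\<close>

definition zword :: "nat list \<Rightarrow> letter list" where
  "zword ks = concat (map (\<lambda>k. replicate k LP @ [LY]) ks)"

text \<open>Linear maps prescribed on the products \<open>z k1 \<cdots> z kn\<close>. Since \<open>zword\<close> is injective
  (see \<open>inj_zword\<close> below), \<open>inv zword\<close> recovers the exponents; words that are not such a
  product are sent to zero.\<close>

definition z_ext :: "(rat \<Rightarrow> 'b) \<Rightarrow> (nat list \<Rightarrow> 'b::ring_1) \<Rightarrow> ncpoly \<Rightarrow> 'b" where
  "z_ext e g = lin_ext e (\<lambda>u. if u \<in> range zword then g (inv zword u) else 0)"

definition U_low :: "nat \<Rightarrow> nat" where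
  "U_low j = (if j = 0 then 2 else 1)"

definition V_low :: "nat \<Rightarrow> nat" where
  "V_low j = (if j = 0 then 1 else 0)"

text \<open>List positions start at \<open>0\<close>, so \<open>low j\<close> is the lower bound of the summation index
  \<open>r\<^sub>j\<^sub>+\<^sub>1\<close>. For \<open>ks = []\<close> the value is \<open>1\<close>.\<close>

definition binom_sum :: "(nat \<Rightarrow> nat) \<Rightarrow> nat list \<Rightarrow> ncpoly" where
  "binom_sum low ks =
     (\<Sum>rs | length rs = length ks \<and> (\<forall>j<length ks. low j \<le> rs ! j \<and> rs ! j \<le> ks ! j).
        const (of_nat (\<Prod>j<length ks. (ks ! j - low j) choose (rs ! j - low j))) * zprod rs)"

definition U :: "ncpoly \<Rightarrow> ncpoly" where
  "U = z_ext const (binom_sum U_low)"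

definition V :: "ncpoly \<Rightarrow> ncpoly" where
  "V = z_ext const (binom_sum V_low)"

text \<open>\<open>U\<close> and \<open>V\<close> are only bijective as maps \<open>h0 \<rightarrow> h0\<close> and \<open>H0 \<rightarrow> H0\<close> (unitriangular
  in the products \<open>zprod ks\<close> spanning these spaces), hence the restricted inverses.\<close>

definition U_inv :: "ncpoly \<Rightarrow> ncpoly" where
  "U_inv = inv_into h0 U"

definition V_inv :: "ncpoly \<Rightarrow> ncpoly" where
  "V_inv = inv_into H0 V"

section \<open>The Ohno--Okuda--Zudilin q-multiple zeta values\<close>

definition decreasing_tuples :: "nat \<Rightarrow> nat list set" where
  "decreasing_tuples n = {ms. length ms = n \<and> sorted_wrt (>) ms \<and> (\<forall>m\<in>set ms. 0 < m)}"

definition ooz_term :: "nat list \<Rightarrow> nat list \<Rightarrow> rat fps" where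
  "ooz_term ks ms =
     fps_X ^ hd ms / (\<Prod>j<length ks. (1 - fps_X ^ (ms ! j)) ^ (ks ! j))"

text \<open>The infinite sum is taken in the \<open>fps_X\<close>-adic topology of \<^typ>\<open>rat fps\<close>; it always
  converges, see \<open>ooz_term_summable\<close> below.\<close>

definition zeta_OOZ_z :: "nat list \<Rightarrow> rat fps" where
  "zeta_OOZ_z ks =
     (if ks = [] then 1 else infsum (ooz_term ks) (decreasing_tuples (length ks)))"

definition zeta_OOZ :: "ncpoly \<Rightarrow> rat fps" where
  "zeta_OOZ = z_ext fps_const zeta_OOZ_z"

section \<open>Characteristic properties of the maps\<close>

lemma const_0 [simp]: "const 0 = 0"
  by (simp add: const_def)

lemma const_1 [simp]: "const 1 = 1"
  by (simp add: const_def)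

lemma const_add: "const (a + b) = const a + const b"
  by (simp add: const_def single_add)

lemma const_mult_single: "const a * Poly_Mapping.single u b = Poly_Mapping.single u (a * b)"
  by (simp add: const_def mult_single)

lemma const_mult: "const (a * b) = const a * const b"
  by (simp add: const_def mult_single)

lemma ncpoly_expand:
  fixes a :: ncpoly
  shows "a = (\<Sum>u\<in>Poly_Mapping.keys a. const (Poly_Mapping.lookup a u) * monomial (letters u))"
proof (rule poly_mapping_eqI)
  fix v
  have "Poly_Mapping.lookup (\<Sum>u\<in>Poly_Mapping.keys a. const (Poly_Mapping.lookup a u) * monomial (letters u)) v
      = (\<Sum>u\<in>Poly_Mapping.keys a. if u = v then Poly_Mapping.lookup a u else 0)"
    by (auto simp: lookup_sum const_def monomial_def mult_single lookup_single when_def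
             intro!: sum.cong)
  also have "\<dots> = Poly_Mapping.lookup a v"
    by (simp add: in_keys_iff)
  finally show "Poly_Mapping.lookup a v = Poly_Mapping.lookup
    (\<Sum>u\<in>Poly_Mapping.keys a. const (Poly_Mapping.lookup a u) * monomial (letters u)) v" ..
qed

lemma const_commute: "const c * a = a * const c"
proof -
  have *: "const c * monomial u = monomial u * const c" for u
    by (simp add: const_def monomial_def mult_single)
  have **: "const c * (const d * monomial u) = const d * monomial u * const c" for d u
    by (simp add: const_def monomial_def mult_single mult.commute)
  have "const c * (\<Sum>u\<in>Poly_Mapping.keys a. const (Poly_Mapping.lookup a u) * monomial (letters u))
      = (\<Sum>u\<in>Poly_Mapping.keys a. const (Poly_Mapping.lookup a u) * monomial (letters u)) * const c"
    by (simp add: sum_distrib_left sum_distrib_right **)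
  then show ?thesis
    by (simp flip: ncpoly_expand)
qed

lemma monomial_Nil [simp]: "monomial [] = 1"
  by (simp add: monomial_def flip: zero_word_def)

lemma monomial_append: "monomial (u @ v) = monomial u * monomial v"
  by (simp add: monomial_def mult_single plus_word_def)

lemma lin_ext_superset:
  assumes "finite S" "Poly_Mapping.keys a \<subseteq> S" "e 0 = 0"
  shows "lin_ext e f a = (\<Sum>u\<in>S. e (Poly_Mapping.lookup a u) * f (letters u))"
  unfolding lin_ext_def
  by (rule sum.mono_neutral_left) (use assms in \<open>auto simp: in_keys_iff\<close>)

lemma lin_ext_add:
  assumes "e 0 = 0" "\<And>c d. e (c + d) = e c + e d"
  shows "lin_ext e f (a + b) = lin_ext e f a + lin_ext e f b"
proof -
  let ?S = "Poly_Mapping.keys a \<union> Poly_Mapping.keys b"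
  have "Poly_Mapping.keys (a + b) \<subseteq> ?S"
    by (rule keys_add)
  then show ?thesis
    by (simp add: lin_ext_superset[of ?S] assms lookup_add distrib_right sum.distrib)
qed

lemma lin_ext_sum:
  assumes "e 0 = 0" "\<And>c d. e (c + d) = e c + e d"
  shows "lin_ext e f (sum g I) = (\<Sum>i\<in>I. lin_ext e f (g i))"
  by (induction I rule: infinite_finite_induct)
    (simp_all add: lin_ext_add[OF assms] lin_ext_def[of _ _ 0])

lemma lin_ext_term:
  assumes "e 0 = 0"
  shows "lin_ext e f (const c * monomial u) = e c * f u"
  by (simp add: lin_ext_def const_def monomial_def mult_single assms)

lemma lin_ext_monomial:
  assumes "e 0 = 0" "e 1 = 1"
  shows "lin_ext e f (monomial u) = f u"
  using lin_ext_term[where e = e and f = f and c = 1 and u = u] assms by simp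

lemma lin_ext_const_mult:
  assumes "e 0 = 0" "\<And>c d. e (c * d) = e c * e d"
  shows "lin_ext e f (const c * a) = e c * lin_ext e f a"
proof -
  have lk: "Poly_Mapping.lookup (const c * a) u = c * Poly_Mapping.lookup a u" for u
    by (simp add: const_def flip: mult_map_scale_conv_mult) (simp add: Poly_Mapping.map.rep_eq when_def)
  then have "Poly_Mapping.keys (const c * a) \<subseteq> Poly_Mapping.keys a"
    by (auto simp: in_keys_iff)
  then show ?thesis
    by (simp add: lin_ext_superset[of "Poly_Mapping.keys a"] assms lk sum_distrib_left mult.assoc)
qed

lemma lin_ext_anti_mult:
  assumes "\<And>u v. Word u \<in> Poly_Mapping.keys a \<Longrightarrow> Word v \<in> Poly_Mapping.keys b \<Longrightarrow> f (u @ v) = f v * f u"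
  shows "lin_ext const f (a * b) = lin_ext const f b * lin_ext const f a"
proof -
  let ?a = "Poly_Mapping.lookup a" and ?b = "Poly_Mapping.lookup b"
  let ?A = "Poly_Mapping.keys a" and ?B = "Poly_Mapping.keys b"
  have 1: "const c * monomial u * (const d * monomial v) = const (c * d) * monomial (u @ v)" for c d u v
    by (simp add: const_def monomial_def mult_single plus_word_def zero_word_def)
  have 2: "const (c * d) * (x * x') = const d * x * (const c * x')" for c d and x x' :: ncpoly
  proof -
    have "const (c * d) * (x * x') = const d * const c * (x * x')"
      by (simp add: mult.commute[of c] flip: const_mult)
    also have "\<dots> = const d * (const c * x) * x'"
      by (simp only: mult.assoc)
    also have "\<dots> = const d * (x * const c) * x'"
      by (simp only: const_commute)
    finally show ?thesis
      by (simp only: mult.assoc)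
  qed
  have "a * b = (\<Sum>u\<in>?A. const (?a u) * monomial (letters u)) * (\<Sum>v\<in>?B. const (?b v) * monomial (letters v))"
    using ncpoly_expand[of a] ncpoly_expand[of b] by simp
  also have "\<dots> = (\<Sum>u\<in>?A. \<Sum>v\<in>?B. const (?a u * ?b v) * monomial (letters u @ letters v))"
    by (simp add: sum_product 1)
  finally have "lin_ext const f (a * b) = (\<Sum>u\<in>?A. \<Sum>v\<in>?B. const (?a u * ?b v) * f (letters u @ letters v))"
    by (simp add: lin_ext_sum lin_ext_term const_add)
  also have "\<dots> = (\<Sum>u\<in>?A. \<Sum>v\<in>?B. const (?a u * ?b v) * (f (letters v) * f (letters u)))"
    by (intro sum.cong refl) (use assms in auto)
  also have "\<dots> = (\<Sum>u\<in>?A. \<Sum>v\<in>?B. (const (?b v) * f (letters v)) * (const (?a u) * f (letters u)))"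
    by (simp add: 2)
  also have "\<dots> = (\<Sum>v\<in>?B. \<Sum>u\<in>?A. (const (?b v) * f (letters v)) * (const (?a u) * f (letters u)))"
    by (rule sum.swap)
  also have "\<dots> = lin_ext const f b * lin_ext const f a"
    by (simp add: lin_ext_def sum_product)
  finally show ?thesis .
qed

lemma tau_tilde_add: "tau_tilde (a + b) = tau_tilde a + tau_tilde b"
  by (simp add: tau_tilde_def lin_ext_add const_add)

lemma tau_tilde_const: "tau_tilde (const c) = const c"
  using lin_ext_term[of const _ c "[]"] by (simp add: tau_tilde_def)

lemma tau_tilde_p: "tau_tilde p = y" and tau_tilde_y: "tau_tilde y = p"
  by (simp_all add: tau_tilde_def p_def y_def lin_ext_monomial)

lemma tau_tilde_mult: "tau_tilde (a * b) = tau_tilde b * tau_tilde a"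
  unfolding tau_tilde_def by (rule lin_ext_anti_mult) (simp add: monomial_append)

lemma tau_add: "tau (a + b) = tau a + tau b"
  by (simp add: tau_def lin_ext_add const_add)

lemma tau_const: "tau (const c) = const c"
  using lin_ext_term[of const _ c "[]"] by (simp add: tau_def)

lemma x1_monomial: "x1 = monomial [LP, LY]"
  by (simp add: x1_def p_def y_def flip: monomial_append)

lemma tau_x0: "tau x0 = x1" and tau_x1: "tau x1 = x0"
  by (simp_all add: tau_def x1_monomial lin_ext_monomial) (simp_all add: x0_def p_def lin_ext_monomial x1_monomial)

lemma tau_word_append:
  assumes "\<And>v'. v \<noteq> LY # v'"
  shows "tau_word (u @ v) = tau_word v @ tau_word u"
proof (induction u rule: tau_word.induct)
  case "3_1"
  show ?case
  proof (cases v)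
    case (Cons l v')
    with assms show ?thesis by (cases l) auto
  qed auto
qed auto

lemma keys_hh: "a \<in> hh \<Longrightarrow> Word (LY # u) \<notin> Poly_Mapping.keys a"
proof (induction a arbitrary: u rule: hh.induct)
  case (add a b)
  then show ?case using keys_add[of a b] by blast
next
  case (mult a b)
  show ?case
  proof
    assume "Word (LY # u) \<in> Poly_Mapping.keys (a * b)"
    then obtain s t where st: "s \<in> Poly_Mapping.keys a" "t \<in> Poly_Mapping.keys b" "Word (LY # u) = s + t"
      using keys_mult[of a b] by blast
    obtain s' t' where [simp]: "s = Word s'" "t = Word t'"
      by (metis word.exhaust)
    from st(3) have "s' = [] \<and> t' = LY # u \<or> (\<exists>s''. s' = LY # s'')"
      by (auto simp: plus_word_def Cons_eq_append_conv)
    with st mult.IH show False by auto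
  qed
qed (auto simp: const_def x0_def p_def x1_monomial monomial_def zero_word_def split: if_splits)

lemma tau_mult:
  assumes "b \<in> hh"
  shows "tau (a * b) = tau b * tau a"
  unfolding tau_def
proof (rule lin_ext_anti_mult)
  fix u v
  assume "Word v \<in> Poly_Mapping.keys b"
  then have "v \<noteq> LY # v'" for v'
    using keys_hh[OF assms] by auto
  then show "monomial (tau_word (u @ v)) = monomial (tau_word v) * monomial (tau_word u)"
    by (simp add: tau_word_append monomial_append)
qed

lemma zword_Nil [simp]: "zword [] = []"
  and zword_Cons: "zword (k # ks) = replicate k LP @ LY # zword ks"
  by (simp_all add: zword_def)

lemma replicate_LP_cancel:
  "replicate k LP @ LY # u = replicate l LP @ LY # v \<Longrightarrow> k = l \<and> u = v"
proof (induction k arbitrary: l)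
  case 0
  then show ?case by (cases l) auto
next
  case (Suc k)
  then show ?case by (cases l) auto
qed

lemma inj_zword: "inj zword"
proof (rule injI)
  fix ks ls
  show "zword ks = zword ls \<Longrightarrow> ks = ls"
  proof (induction ks arbitrary: ls)
    case Nil
    then show ?case by (cases ls) (auto simp: zword_Cons)
  next
    case (Cons k ks)
    then show ?case
      by (cases ls) (auto simp: zword_Cons dest: replicate_LP_cancel)
  qed
qed

lemma p_power: "p ^ k = monomial (replicate k LP)"
  by (induction k) (simp_all add: p_def flip: monomial_append)

lemma zprod_monomial: "zprod ks = monomial (zword ks)"
proof (induction ks)
  case (Cons k ks)
  then show ?case
    by (simp add: zprod_def z_def p_power y_def zword_Cons flip: monomial_append)
qed (simp add: zprod_def)

lemma z_ext_zprod:
  assumes "e 0 = 0" "e 1 = 1"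
  shows "z_ext e g (zprod ks) = g ks"
  by (simp add: z_ext_def zprod_monomial lin_ext_monomial assms inv_f_f[OF inj_zword])

lemma U_add: "U (a + b) = U a + U b"
  by (simp add: U_def z_ext_def lin_ext_add const_add)

lemma U_scale: "U (const c * a) = const c * U a"
  by (simp add: U_def z_ext_def lin_ext_const_mult const_mult)

lemma U_zprod: "U (zprod ks) = binom_sum U_low ks"
  by (simp add: U_def z_ext_zprod)

lemma V_add: "V (a + b) = V a + V b"
  by (simp add: V_def z_ext_def lin_ext_add const_add)

lemma V_scale: "V (const c * a) = const c * V a"
  by (simp add: V_def z_ext_def lin_ext_const_mult const_mult)

lemma V_zprod: "V (zprod ks) = binom_sum V_low ks"
  by (simp add: V_def z_ext_zprod)

lemma binom_sum_Nil: "binom_sum low [] = 1"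
proof -
  have "{rs. length rs = length ([] :: nat list) \<and>
      (\<forall>j<length ([] :: nat list). low j \<le> rs ! j \<and> rs ! j \<le> [] ! j)} = {[]}"
    by auto
  then show ?thesis
    by (simp add: binom_sum_def zprod_def)
qed

lemma zeta_OOZ_add: "zeta_OOZ (a + b) = zeta_OOZ a + zeta_OOZ b"
  by (simp add: zeta_OOZ_def z_ext_def lin_ext_add flip: fps_const_add)

lemma zeta_OOZ_scale: "zeta_OOZ (const c * a) = fps_const c * zeta_OOZ a"
  by (simp add: zeta_OOZ_def z_ext_def lin_ext_const_mult flip: fps_const_mult)

lemma zeta_OOZ_zprod: "zeta_OOZ (zprod ks) = zeta_OOZ_z ks"
  by (simp add: zeta_OOZ_def z_ext_zprod)

lemma finite_decreasing_tuples_hd_le: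
  "finite {ms \<in> decreasing_tuples n. ms \<noteq> [] \<and> hd ms \<le> N}"
proof (rule finite_subset)
  show "finite {ms. set ms \<subseteq> {..N} \<and> length ms = n}"
    by (rule finite_lists_length_eq) simp
  show "{ms \<in> decreasing_tuples n. ms \<noteq> [] \<and> hd ms \<le> N} \<subseteq> {ms. set ms \<subseteq> {..N} \<and> length ms = n}"
  proof safe
    fix ms x
    assume *: "ms \<in> decreasing_tuples n" "ms \<noteq> []" "hd ms \<le> N" "x \<in> set ms"
    then obtain m ms' where "ms = m # ms'" by (cases ms) auto
    with * show "x \<le> N" by (auto simp: decreasing_tuples_def)
  qed (simp add: decreasing_tuples_def)
qed

lemma ooz_term_nth_eq_0:
  assumes "length ms = length ks" "\<forall>m\<in>set ms. 0 < m" "N < hd ms"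
  shows "fps_nth (ooz_term ks ms) N = 0"
proof -
  let ?D = "\<Prod>j<length ks. (1 - fps_X ^ (ms ! j) :: rat fps) ^ (ks ! j)"
  have prod_nth_0: "fps_nth (prod f A) 0 = (\<Prod>i\<in>A. fps_nth (f i) 0)"
    for f :: "nat \<Rightarrow> rat fps" and A
    by (induction A rule: infinite_finite_induct) simp_all
  have "fps_nth (1 - fps_X ^ (ms ! j) :: rat fps) 0 = 1" if "j < length ks" for j
    using that assms(1,2) by (auto simp: fps_X_power_nth)
  then have "fps_nth ?D 0 = 1"
    unfolding prod_nth_0 fps_power_zeroth by (intro prod.neutral) (simp only: power_one lessThan_iff Ball_def, simp)
  then have "ooz_term ks ms = fps_X ^ hd ms * inverse ?D"
    unfolding ooz_term_def by (intro fps_divide_unit) simp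
  with assms(3) show ?thesis
    by (simp add: fps_X_power_mult_nth)
qed

lemma ooz_term_summable:
  assumes "ks \<noteq> []"
  shows "ooz_term ks summable_on decreasing_tuples (length ks)"
proof -
  define T where "T = decreasing_tuples (length ks)"
  define F where "F N = {ms \<in> T. ms \<noteq> [] \<and> hd ms \<le> N}" for N
  define S where "S = Abs_fps (\<lambda>N. fps_nth (\<Sum>ms\<in>F N. ooz_term ks ms) N)"
  have fin: "finite (F N)" for N
    unfolding F_def T_def by (rule finite_decreasing_tuples_hd_le)
  have "(sum (ooz_term ks) \<longlongrightarrow> S) (finite_subsets_at_top T)"
    unfolding tendsto_fps_iff
  proof
    fix N
    show "\<forall>\<^sub>F A in finite_subsets_at_top T. fps_nth (sum (ooz_term ks) A) N = fps_nth S N"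
      unfolding eventually_finite_subsets_at_top
    proof (intro exI[of _ "F N"] conjI allI impI)
      fix A
      assume A: "finite A \<and> F N \<subseteq> A \<and> A \<subseteq> T"
      have "fps_nth (ooz_term ks ms) N = 0" if "ms \<in> A - F N" for ms
      proof (rule ooz_term_nth_eq_0)
        have "ms \<in> T" using that A by auto
        then show "length ms = length ks" "\<forall>m\<in>set ms. 0 < m"
          by (auto simp: T_def decreasing_tuples_def)
        with \<open>ms \<in> T\<close> that assms show "N < hd ms"
          by (auto simp: F_def)
      qed
      then have "(\<Sum>ms\<in>A. fps_nth (ooz_term ks ms) N) = (\<Sum>ms\<in>F N. fps_nth (ooz_term ks ms) N)"
        using A by (intro sum.mono_neutral_right) auto
      then show "fps_nth (sum (ooz_term ks) A) N = fps_nth S N"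
        by (simp add: S_def fps_sum_nth)
    qed (use fin[of N] in \<open>auto simp: F_def\<close>)
  qed
  then show ?thesis
    unfolding T_def summable_on_def has_sum_def by blast
qed

end

theory Submission
  imports Defs
begin

text \<open>
  \<open>V\<close> and \<open>U\<close> come from the substitution \<open>p \<mapsto> p + 1\<close>, and \<open>1 / (1 - q^m) = q^m / (1 - q^m) + 1\<close>;
  so \<open>zeta_OOZ\<close> becomes, after \<open>V\<close> resp. \<open>U\<close>, a multiple \<open>q\<close>-sum in which a letter \<open>p\<close> resp. \<open>x0\<close>
  contributes \<open>q^m / (1 - q^m)\<close> and a letter \<open>y\<close> resp. \<open>x1\<close> opens a new summation index \<open>m\<close> with
  weight \<open>1\<close> (the Schlesinger--Zudilin model) resp. \<open>1 / (1 - q^m)\<close> (the Bradley--Zhao model).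
  Duality of both models follows by the connected sum method of Seki and Yamamoto: two such sums
  with outermost indices \<open>m\<close>, \<open>n\<close> are joined by a symmetric factor \<open>C m n\<close> whose telescoping in one
  index lets the letters move one at a time from one word to the other, exchanging the two letters.
  The connectors are \<open>q^(m n)\<close> and \<open>q^(m n) (q)_m (q)_n / (q)_(m+n)\<close>.
  For the inverses of \<open>U\<close> and \<open>V\<close> only surjectivity matters, as \<open>zeta_OOZ a\<close> depends only on
  the image of \<open>a\<close>.
\<close>

section \<open>Connected sums\<close>

definition geom :: "nat \<Rightarrow> rat fps" where
  "geom m = inverse (1 - fps_X ^ m)"

definition pgeom :: "nat \<Rightarrow> rat fps" where
  "pgeom m = fps_X ^ m * geom m"

text \<open>\<open>1 - fps_X ^ 0\<close> is zero, so \<open>inverse\<close> returns its default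
  value 0; this makes words starting with \<open>LP\<close> vanish at the index 0.\<close>

lemma geom_0 [simp]: "geom 0 = 0" and pgeom_0 [simp]: "pgeom 0 = 0"
  by (simp_all add: geom_def pgeom_def)

lemma geom_inverse: "m > 0 \<Longrightarrow> geom m * (1 - fps_X ^ m) = 1"
  unfolding geom_def by (rule inverse_mult_eq_1) simp

lemma geom_eq: "m > 0 \<Longrightarrow> geom m = pgeom m + 1"
  using geom_inverse[of m] by (simp add: pgeom_def algebra_simps)

text \<open>\<open>m\<close> is the outermost, i.e. largest, summation index; \<open>m = 0\<close> stands for the empty sum
  and contributes only for the empty word.\<close>

fun weight :: "(nat \<Rightarrow> rat fps) \<Rightarrow> letter list \<Rightarrow> nat \<Rightarrow> rat fps" where
  "weight c [] m = (if m = 0 then 1 else 0)"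
| "weight c (LP # u) m = pgeom m * weight c u m"
| "weight c (LY # u) m = c m * (\<Sum>a<m. weight c u a)"

lemma weight_0 [simp]: "u \<noteq> [] \<Longrightarrow> weight c u 0 = 0"
  by (cases "(c, u, 0::nat)" rule: weight.cases) auto

text \<open>\<open>step\<close> is the difference equation in \<open>n\<close> behind the transport
  of letters, \<open>C_0\<close> removes the connector next to an empty word, and \<open>dvd\<close>
  pushes boundary terms beyond the coefficient considered.\<close>

locale connector =
  fixes C :: "nat \<Rightarrow> nat \<Rightarrow> rat fps" and c :: "nat \<Rightarrow> rat fps"
  assumes sym: "C m n = C n m"
    and C_0: "C m 0 = 1"
    and dvd: "fps_X ^ (m * n) dvd C m n"
    and step: "m > 0 \<Longrightarrow> c (Suc n) * C m (Suc n) = pgeom m * (C m n - C m (Suc n))"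
begin

text \<open>Both indices are cut off at the degree \<open>N\<close> of the coefficient, which keeps
  all sums finite; the identities below hold exactly for these truncations.\<close>

definition connected_sum :: "nat \<Rightarrow> letter list \<Rightarrow> letter list \<Rightarrow> rat" where
  "connected_sum N u v = (\<Sum>m\<le>N. \<Sum>n\<le>N. fps_nth (weight c u m * C m n * weight c v n) N)"

lemma connected_sum_sym: "connected_sum N u v = connected_sum N v u"
proof -
  have *: "weight c u m * C m n * weight c v n = weight c v n * C n m * weight c u m" for m n
    unfolding sym[of m n] by (simp only: mult_ac)
  show ?thesis
    unfolding connected_sum_def by (subst sum.swap) (simp only: *)
qed

lemma connected_sum_Nil: "connected_sum N u [] = (\<Sum>m\<le>N. fps_nth (weight c u m) N)"
proof -
  have "(\<Sum>n\<le>N. fps_nth (weight c u m * C m n * weight c [] n) N) = fps_nth (weight c u m) N" for m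
    by (subst sum.remove[of _ 0]) (auto simp: C_0 intro!: sum.neutral)
  then show ?thesis
    by (simp add: connected_sum_def)
qed

text \<open>Abel summation: for positive \<open>n\<close>, \<open>step\<close> makes
  \<open>c n * C m n\<close> equal to \<open>pgeom m\<close> times a difference of consecutive
  values of \<open>C m\<close>. The subtracted term is the boundary at \<open>N\<close>.\<close>

lemma sum_by_parts:
  assumes "m > 0"
  shows "(\<Sum>n\<le>N. C m n * (c n * (\<Sum>b<n. g b)))
       = (\<Sum>b\<le>N. pgeom m * C m b * g b) - pgeom m * C m N * (\<Sum>b\<le>N. g b)"
proof (induction N)
  case (Suc N)
  have "C m (Suc N) * (c (Suc N) * (\<Sum>b<Suc N. g b)) = c (Suc N) * C m (Suc N) * (\<Sum>b\<le>N. g b)"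
    by (simp only: lessThan_Suc_atMost mult_ac)
  also have "\<dots> = pgeom m * C m N * (\<Sum>b\<le>N. g b) - pgeom m * C m (Suc N) * (\<Sum>b\<le>N. g b)"
    by (simp only: step[OF assms] left_diff_distrib right_diff_distrib)
  finally show ?case
    unfolding sum.atMost_Suc Suc by (simp only: distrib_left) simp
qed simp

lemma transport:
  assumes "u \<noteq> []"
  shows "connected_sum N (LP # u) v = connected_sum N u (LY # v)"
  unfolding connected_sum_def
proof (rule sum.cong[OF refl])
  fix m
  show "(\<Sum>n\<le>N. fps_nth (weight c (LP # u) m * C m n * weight c v n) N)
      = (\<Sum>n\<le>N. fps_nth (weight c u m * C m n * weight c (LY # v) n) N)"
  proof (cases "m = 0")
    case False
    then have "m > 0" by simp
    have "(\<Sum>n\<le>N. weight c u m * C m n * weight c (LY # v) n)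
        = weight c u m * (\<Sum>n\<le>N. C m n * (c n * (\<Sum>b<n. weight c v b)))"
      by (simp add: sum_distrib_left mult_ac)
    also have "\<dots> = (\<Sum>n\<le>N. weight c (LP # u) m * C m n * weight c v n)
        - pgeom m * C m N * (weight c u m * (\<Sum>b\<le>N. weight c v b))"
      unfolding sum_by_parts[OF \<open>m > 0\<close>] by (simp add: sum_distrib_left algebra_simps)
    finally have eq: "(\<Sum>n\<le>N. weight c u m * C m n * weight c (LY # v) n)
      = (\<Sum>n\<le>N. weight c (LP # u) m * C m n * weight c v n) - pgeom m * C m N * (weight c u m * (\<Sum>b\<le>N. weight c v b))" .
    \<comment> \<open>The boundary term has order at least \<open>m + m * N > N\<close>, so it does
      not reach coefficient \<open>N\<close>.\<close>
    have "fps_X ^ m * fps_X ^ (m * N) dvd pgeom m * C m N"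
      unfolding pgeom_def by (intro mult_dvd_mono dvd dvd_triv_left)
    then obtain r where "pgeom m * C m N = fps_X ^ (m + m * N) * r"
      by (auto simp: power_add elim: dvdE)
    moreover have "N < m + m * N"
      using \<open>m > 0\<close> by (cases m) auto
    ultimately have "fps_nth (pgeom m * C m N * (weight c u m * (\<Sum>b\<le>N. weight c v b))) N = 0"
      by (simp add: mult.assoc fps_X_power_mult_nth)
    with arg_cong[OF eq, of "\<lambda>f. fps_nth f N"] show ?thesis
      by (simp add: fps_sum_nth)
  qed (use assms in simp)
qed

lemma transport': "v \<noteq> [] \<Longrightarrow> connected_sum N (LY # u) v = connected_sum N u (LP # v)"
  using transport[of v N u] connected_sum_sym[of N "LY # u" v] connected_sum_sym[of N u "LP # v"] by simp

text \<open>Letters leave the front of the left word and enter the front of the right one, which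
  produces the reversal. The final \<open>LY\<close> keeps the left word nonempty for
  \<open>transport\<close>; it is itself moved last by \<open>transport'\<close>, which only asks
  for a nonempty \<open>v\<close>.\<close>

lemma transport_word:
  "v \<noteq> [] \<Longrightarrow> connected_sum N (u @ [LY]) v = connected_sum N [] (LP # rev (map swap_letter u) @ v)"
proof (induction u arbitrary: v)
  case (Cons l u)
  then show ?case
    by (cases l) (simp_all add: transport transport')
qed (simp add: transport')

lemma duality:
  assumes "u = LP # u' @ [LY]"
  shows "(\<Sum>m\<le>N. fps_nth (weight c u m) N) = (\<Sum>m\<le>N. fps_nth (weight c (rev (map swap_letter u)) m) N)"
proof -
  \<comment> \<open>The right word is still empty, which \<open>transport\<close> permits and
    \<open>transport'\<close> does not; hence the word has to start with \<open>LP\<close>.\<close>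
  have "connected_sum N u [] = connected_sum N (u' @ [LY]) [LY]"
    by (simp add: assms transport)
  also have "\<dots> = connected_sum N (rev (map swap_letter u)) []"
    by (simp add: assms transport_word connected_sum_sym[of _ "[]"])
  finally show ?thesis
    by (simp add: connected_sum_Nil)
qed

end

section \<open>The Schlesinger-Zudilin and Bradley-Zhao connectors\<close>

lemma connector_SZ: "connector (\<lambda>m n. fps_X ^ (m * n)) (\<lambda>m. 1)"
proof
  fix m n :: nat assume m: "m > 0"
  \<comment> \<open>The difference contains the factor \<open>1 - fps_X ^ m\<close>, which cancels
    the denominator of \<open>pgeom m\<close>.\<close>
  have "pgeom m * (fps_X ^ (m * n) - fps_X ^ (m * Suc n))
      = geom m * (1 - fps_X ^ m) * (fps_X ^ m * fps_X ^ (m * n))"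
    by (simp add: pgeom_def power_add algebra_simps)
  then show "1 * fps_X ^ (m * Suc n) = pgeom m * (fps_X ^ (m * n) - fps_X ^ (m * Suc n))"
    by (simp add: geom_inverse[OF m] power_add)
qed (simp_all add: mult.commute)

text \<open>The \<open>q\<close>-Pochhammer symbol \<open>(q; q)_n\<close>.\<close>

definition qfact :: "nat \<Rightarrow> rat fps" where
  "qfact n = (\<Prod>i<n. 1 - fps_X ^ Suc i)"

lemma qfact_0 [simp]: "qfact 0 = 1"
  and qfact_Suc: "qfact (Suc n) = (1 - fps_X ^ Suc n) * qfact n"
  by (simp_all add: qfact_def)

lemma qfact_inverse: "inverse (qfact n) * qfact n = 1"
proof (rule inverse_mult_eq_1)
  have "fps_nth (qfact n) 0 = 1"
    by (induction n) (simp_all add: qfact_Suc)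
  then show "fps_nth (qfact n) 0 \<noteq> 0" by simp
qed

lemma connector_BZ:
  "connector (\<lambda>m n. fps_X ^ (m * n) * qfact m * qfact n * inverse (qfact (m + n))) geom"
proof
  fix m n :: nat assume m: "m > 0"
  let ?D = "inverse (qfact (m + Suc n))"
  define x y :: "rat fps" where "x = fps_X ^ m" and "y = fps_X ^ Suc n"
  have D: "inverse (qfact (m + n)) = (1 - x * y) * ?D"
  proof -
    have "qfact (m + Suc n) = (1 - x * y) * qfact (m + n)"
      by (simp add: qfact_Suc x_def y_def power_add mult_ac)
    then have "inverse (qfact (m + n)) * (?D * qfact (m + Suc n))
        = (inverse (qfact (m + n)) * qfact (m + n)) * ((1 - x * y) * ?D)"
      by (simp only: mult_ac)
    then show ?thesis
      by (simp only: qfact_inverse mult_1_left mult_1_right)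
  qed
  \<comment> \<open>With this common factor, \<open>C m n = (1 - x * y) * Z\<close> and
    \<open>C m (Suc n) = x * (1 - y) * Z\<close>. The claim then rests on
    \<open>(1 - x * y) - x * (1 - y) = 1 - x\<close>, which cancels the denominator of
    \<open>pgeom m\<close>.\<close>
  define Z where "Z = fps_X ^ (m * n) * qfact m * qfact n * ?D"
  have "geom (Suc n) * (fps_X ^ (m * Suc n) * qfact m * qfact (Suc n) * ?D)
      = (geom (Suc n) * (1 - y)) * (x * Z)"
    by (simp add: qfact_Suc x_def y_def power_add Z_def mult_ac)
  also have "\<dots> = x * Z"
    by (simp add: geom_inverse y_def del: power_Suc)
  also have "\<dots> = (geom m * (1 - x)) * (x * Z)"
    using m by (simp add: geom_inverse x_def)
  also have "\<dots> = pgeom m * ((1 - x * y) * Z - x * (1 - y) * Z)"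
    by (simp add: pgeom_def x_def algebra_simps)
  also have "(1 - x * y) * Z = fps_X ^ (m * n) * qfact m * qfact n * inverse (qfact (m + n))"
    by (simp only: D Z_def mult_ac)
  also have "x * (1 - y) * Z = fps_X ^ (m * Suc n) * qfact m * qfact (Suc n) * ?D"
    by (simp add: qfact_Suc x_def y_def power_add Z_def mult_ac)
  finally show "geom (Suc n) * (fps_X ^ (m * Suc n) * qfact m * qfact (Suc n) * ?D)
     = pgeom m * (fps_X ^ (m * n) * qfact m * qfact n * inverse (qfact (m + n))
         - fps_X ^ (m * Suc n) * qfact m * qfact (Suc n) * ?D)" .
next
  fix m show "fps_X ^ (m * 0) * qfact m * qfact 0 * inverse (qfact (m + 0)) = 1"
    using qfact_inverse[of m] by (simp add: mult.commute)
next
  fix m n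
  show "fps_X ^ (m * n) * qfact m * qfact n * inverse (qfact (m + n))
      = fps_X ^ (n * m) * qfact n * qfact m * inverse (qfact (n + m))"
    by (simp only: mult_ac add.commute)
  show "fps_X ^ (m * n) dvd fps_X ^ (m * n) * qfact m * qfact n * inverse (qfact (m + n))"
    by (simp only: mult.assoc dvd_triv_left)
qed

section \<open>Coefficients of the Ohno--Okuda--Zudilin values\<close>

text \<open>The numerator \<open>q^m\<close> of the outermost index is left out, so that inner
  tuples obey the same recursion.\<close>

fun ooz_weight :: "nat list \<Rightarrow> nat \<Rightarrow> rat fps" where
  "ooz_weight [] m = (if m = 0 then 1 else 0)"
| "ooz_weight (k # ks) m = geom m ^ k * (\<Sum>a<m. ooz_weight ks a)"

definition tuples_below :: "nat \<Rightarrow> nat \<Rightarrow> nat list set" where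
  "tuples_below n M = {ms \<in> decreasing_tuples n. \<forall>x\<in>set ms. x < M}"

lemma finite_tuples_below: "finite (tuples_below n M)"
  by (rule finite_subset[OF _ finite_lists_length_eq[of "{..<M}" n]])
    (auto simp: tuples_below_def decreasing_tuples_def)

lemma tuples_below_0: "tuples_below 0 M = {[]}"
  by (auto simp: tuples_below_def decreasing_tuples_def)

lemma tuples_below_Suc:
  "tuples_below (Suc n) M = (\<lambda>(m, ms). m # ms) ` (SIGMA m:{0<..<M}. tuples_below n m)"
proof (intro equalityI subsetI)
  fix ms assume "ms \<in> tuples_below (Suc n) M"
  then show "ms \<in> (\<lambda>(m, ms). m # ms) ` (SIGMA m:{0<..<M}. tuples_below n m)"
    by (cases ms) (auto simp: tuples_below_def decreasing_tuples_def image_iff)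
next
  fix ms assume "ms \<in> (\<lambda>(m, ms). m # ms) ` (SIGMA m:{0<..<M}. tuples_below n m)"
  then obtain m ms' where "ms = m # ms'" "0 < m" "m < M" "ms' \<in> tuples_below n m"
    by auto
  then show "ms \<in> tuples_below (Suc n) M"
    by (fastforce simp: tuples_below_def decreasing_tuples_def)
qed

lemma sum_tuples_below_Suc:
  "(\<Sum>ms\<in>tuples_below (Suc n) M. g ms) = (\<Sum>m\<in>{0<..<M}. \<Sum>ms\<in>tuples_below n m. g (m # ms))"
proof -
  have "(\<Sum>ms\<in>tuples_below (Suc n) M. g ms) = (\<Sum>(m, ms)\<in>(SIGMA m:{0<..<M}. tuples_below n m). g (m # ms))"
    unfolding tuples_below_Suc by (subst sum.reindex) (auto simp: inj_on_def case_prod_beta)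
  also have "\<dots> = (\<Sum>m\<in>{0<..<M}. \<Sum>ms\<in>tuples_below n m. g (m # ms))"
    by (rule sum.Sigma[symmetric]) (auto simp: finite_tuples_below)
  finally show ?thesis .
qed

text \<open>Induction on the outermost entry. \<open>M > 0\<close> matters for the empty list: the
  empty tuple corresponds to the index \<open>a = 0\<close> on the right.\<close>

lemma sum_tuples_below:
  assumes "M > 0"
  shows "(\<Sum>ms\<in>tuples_below (length ks) M. \<Prod>j<length ks. geom (ms ! j) ^ (ks ! j)) = (\<Sum>a<M. ooz_weight ks a)"
  using assms
proof (induction ks arbitrary: M)
  case Nil
  then show ?case
    by (simp add: tuples_below_0)
next
  case (Cons k ks)
  have "(\<Sum>ms\<in>tuples_below (length (k # ks)) M. \<Prod>j<length (k # ks). geom (ms ! j) ^ ((k # ks) ! j))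
      = (\<Sum>m\<in>{0<..<M}. \<Sum>ms\<in>tuples_below (length ks) m. geom m ^ k * (\<Prod>j<length ks. geom (ms ! j) ^ (ks ! j)))"
    by (simp add: sum_tuples_below_Suc prod.lessThan_Suc_shift del: prod.lessThan_Suc)
  also have "\<dots> = (\<Sum>m\<in>{0<..<M}. ooz_weight (k # ks) m)"
    by (simp add: Cons.IH flip: sum_distrib_left)
  also have "\<dots> = (\<Sum>m<M. ooz_weight (k # ks) m)"
    by (rule sum.mono_neutral_left) (auto intro: Suc_leI)
  finally show ?case .
qed

lemma ooz_term_eq:
  assumes "ms \<in> decreasing_tuples (length ks)"
  shows "ooz_term ks ms = fps_X ^ hd ms * (\<Prod>j<length ks. geom (ms ! j) ^ (ks ! j))"
proof -
  let ?D = "\<Prod>j<length ks. (1 - fps_X ^ (ms ! j)) ^ (ks ! j) :: rat fps"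
  let ?E = "\<Prod>j<length ks. geom (ms ! j) ^ (ks ! j)"
  have "?E * ?D = (\<Prod>j<length ks. (geom (ms ! j) * (1 - fps_X ^ (ms ! j))) ^ (ks ! j))"
    by (simp add: prod.distrib power_mult_distrib)
  also have "\<dots> = 1"
    using assms by (intro prod.neutral) (auto simp: decreasing_tuples_def geom_inverse)
  finally have ED: "?E * ?D = 1" .
  then have "?D \<noteq> 0"
    by (metis mult_zero_right zero_neq_one)
  have "ooz_term ks ms = fps_X ^ hd ms * ?E * ?D / ?D"
    by (simp only: ooz_term_def mult.assoc ED mult_1_right)
  also have "\<dots> = fps_X ^ hd ms * ?E"
    by (rule nonzero_mult_div_cancel_right) fact
  finally show ?thesis .
qed

text \<open>Convergence in the \<open>fps_X\<close>-adic topology means that coefficient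
  \<open>N\<close> of the finite partial sums is eventually constant. A stage \<open>B\<close> where
  this holds is enlarged by the set \<open>F\<close> of tuples with entries at most
  \<open>N\<close>; tuples outside \<open>F\<close> have a head above \<open>N\<close> and
  contribute 0.\<close>

lemma zeta_OOZ_z_nth:
  assumes "ks \<noteq> []"
  shows "fps_nth (zeta_OOZ_z ks) N = (\<Sum>m\<le>N. fps_nth (fps_X ^ m * ooz_weight ks m) N)"
proof -
  obtain k ks' where ks: "ks = k # ks'"
    using assms by (cases ks) auto
  define T where "T = decreasing_tuples (length ks)"
  define F where "F = tuples_below (length ks) (Suc N)"
  have "(ooz_term ks has_sum zeta_OOZ_z ks) T"
    using has_sum_infsum[OF ooz_term_summable[OF assms]] assms by (simp add: zeta_OOZ_z_def T_def)
  then have "\<forall>\<^sub>F A in finite_subsets_at_top T. fps_nth (sum (ooz_term ks) A) N = fps_nth (zeta_OOZ_z ks) N"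
    by (auto simp: has_sum_def tendsto_fps_iff)
  then obtain B where B: "finite B \<and> B \<subseteq> T \<and> (\<forall>A. finite A \<and> B \<subseteq> A \<and> A \<subseteq> T \<longrightarrow>
      fps_nth (sum (ooz_term ks) A) N = fps_nth (zeta_OOZ_z ks) N)"
    unfolding eventually_finite_subsets_at_top by (elim exE)
  have F: "finite F" "F \<subseteq> T"
    by (auto simp: F_def T_def finite_tuples_below) (simp add: tuples_below_def)
  have "fps_nth (zeta_OOZ_z ks) N = (\<Sum>ms\<in>B \<union> F. fps_nth (ooz_term ks ms) N)"
  proof -
    have "fps_nth (sum (ooz_term ks) (B \<union> F)) N = fps_nth (zeta_OOZ_z ks) N"
      using B F by blast
    then show ?thesis
      by (simp only: fps_sum_nth)
  qed
  also have "\<dots> = (\<Sum>ms\<in>F. fps_nth (ooz_term ks ms) N)"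
  proof (rule sum.mono_neutral_right)
    show "\<forall>ms\<in>B \<union> F - F. fps_nth (ooz_term ks ms) N = 0"
    proof
      fix ms assume ms: "ms \<in> B \<union> F - F"
      then have "ms \<in> T" "ms \<notin> F"
        using B F by auto
      then obtain m ms' where "ms = m # ms'"
        by (cases ms) (auto simp: T_def decreasing_tuples_def ks)
      with \<open>ms \<in> T\<close> have *: "length ms = length ks" "\<forall>m\<in>set ms. 0 < m"
          "m < Suc N \<Longrightarrow> \<forall>x\<in>set ms. x < Suc N"
        by (auto simp: T_def decreasing_tuples_def)
      have "\<not> m < Suc N"
        using \<open>ms \<in> T\<close> \<open>ms \<notin> F\<close> *(3) by (auto simp: T_def F_def tuples_below_def)
      with * show "fps_nth (ooz_term ks ms) N = 0"
        by (intro ooz_term_nth_eq_0) (simp_all add: \<open>ms = m # ms'\<close>)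
    qed
  next
    show "finite (B \<union> F)"
      using B F by blast
  qed simp
  also have "\<dots> = (\<Sum>ms\<in>F. fps_nth (fps_X ^ hd ms * (\<Prod>j<length ks. geom (ms ! j) ^ (ks ! j))) N)"
    using F by (intro sum.cong refl) (simp add: ooz_term_eq T_def subset_iff)
  also have "\<dots> = (\<Sum>m\<in>{0<..<Suc N}. \<Sum>ms\<in>tuples_below (length ks') m.
      fps_nth (fps_X ^ m * (geom m ^ k * (\<Prod>j<length ks'. geom (ms ! j) ^ (ks' ! j)))) N)"
    by (simp add: F_def ks sum_tuples_below_Suc prod.lessThan_Suc_shift del: prod.lessThan_Suc)
  also have "\<dots> = (\<Sum>m\<in>{0<..<Suc N}. fps_nth (fps_X ^ m * ooz_weight ks m) N)"
  proof (rule sum.cong[OF refl])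
    fix m assume "m \<in> {0<..<Suc N}"
    then have "m > 0" by simp
    show "(\<Sum>ms\<in>tuples_below (length ks') m.
        fps_nth (fps_X ^ m * (geom m ^ k * (\<Prod>j<length ks'. geom (ms ! j) ^ (ks' ! j)))) N)
      = fps_nth (fps_X ^ m * ooz_weight ks m) N"
      unfolding ks ooz_weight.simps sum_tuples_below[OF \<open>m > 0\<close>, symmetric]
      by (simp only: fps_sum_nth[symmetric] sum_distrib_left[symmetric])
  qed
  \<comment> \<open>The added index 0 contributes nothing: its inner sum is empty.\<close>
  also have "\<dots> = (\<Sum>m\<le>N. fps_nth (fps_X ^ m * ooz_weight ks m) N)"
    by (rule sum.mono_neutral_left) (auto simp: ks Suc_le_eq)
  finally show ?thesis .
qed

section \<open>The maps U and V on spans of admissible products\<close>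

text \<open>Scalars act through \<open>const\<close>, which makes the theory of spans and subspaces
  available.\<close>

interpretation ncp: vector_space "\<lambda>c (a :: ncpoly). const c * a"
  by standard (simp_all add: distrib_left distrib_right const_add const_mult mult.assoc)

definition binom_range :: "(nat \<Rightarrow> nat) \<Rightarrow> nat list \<Rightarrow> nat list set" where
  "binom_range low ks = {rs. length rs = length ks \<and> (\<forall>j<length ks. low j \<le> rs ! j \<and> rs ! j \<le> ks ! j)}"

definition binom_coeff :: "(nat \<Rightarrow> nat) \<Rightarrow> nat list \<Rightarrow> nat list \<Rightarrow> nat" where
  "binom_coeff low ks rs = (\<Prod>j<length ks. (ks ! j - low j) choose (rs ! j - low j))"

lemma binom_sum_eq:
  "binom_sum low ks = (\<Sum>rs\<in>binom_range low ks. const (of_nat (binom_coeff low ks rs)) * zprod rs)"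
  by (simp add: binom_sum_def binom_range_def binom_coeff_def)

lemma binom_range_Nil: "binom_range low [] = {[]}"
  by (auto simp: binom_range_def)

lemma binom_range_Cons:
  "binom_range low (k # ks) = (\<lambda>(r, rs). r # rs) ` ({low 0..k} \<times> binom_range (low \<circ> Suc) ks)"
proof (intro equalityI subsetI)
  fix rs assume "rs \<in> binom_range low (k # ks)"
  then show "rs \<in> (\<lambda>(r, rs). r # rs) ` ({low 0..k} \<times> binom_range (low \<circ> Suc) ks)"
    by (cases rs) (auto simp: binom_range_def image_iff)
next
  fix rs assume "rs \<in> (\<lambda>(r, rs). r # rs) ` ({low 0..k} \<times> binom_range (low \<circ> Suc) ks)"
  then show "rs \<in> binom_range low (k # ks)"
    by (auto simp: binom_range_def nth_Cons split: nat.splits)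
qed

lemma binom_coeff_Cons:
  "binom_coeff low (k # ks) (r # rs) = ((k - low 0) choose (r - low 0)) * binom_coeff (low \<circ> Suc) ks rs"
  by (simp add: binom_coeff_def prod.lessThan_Suc_shift del: prod.lessThan_Suc)

text \<open>The summand \<open>h\<close> is general because the same splitting serves
  \<open>binom_sum\<close> and the weights of the model sums.\<close>

lemma sum_binom_Cons:
  "(\<Sum>rs\<in>binom_range low (k # ks). h (binom_coeff low (k # ks) rs) rs)
   = (\<Sum>r=low 0..k. \<Sum>rs\<in>binom_range (low \<circ> Suc) ks.
        h (((k - low 0) choose (r - low 0)) * binom_coeff (low \<circ> Suc) ks rs) (r # rs))"
  unfolding binom_range_Cons sum.cartesian_product
  by (subst sum.reindex) (auto simp: inj_on_def binom_coeff_Cons case_prod_beta)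

text \<open>For \<open>l \<le> k\<close> this is \<open>p ^ l * (p + 1) ^ (k - l) * y\<close>,
  expanded by the binomial theorem.\<close>

definition z_binom :: "nat \<Rightarrow> nat \<Rightarrow> ncpoly" where
  "z_binom l k = (\<Sum>r=l..k. const (of_nat ((k - l) choose (r - l))) * z r)"

lemma zprod_Nil [simp]: "zprod [] = 1" and zprod_Cons: "zprod (k # ks) = z k * zprod ks"
  by (simp_all add: zprod_def)

lemma binom_sum_Cons: "binom_sum low (k # ks) = z_binom (low 0) k * binom_sum (low \<circ> Suc) ks"
proof -
  have eq: "const (of_nat (a * b)) * (x * x') = const (of_nat a) * x * (const (of_nat b) * x')" for a b x x'
  proof -
    have "const (of_nat (a * b)) * (x * x') = const (of_nat a) * (const (of_nat b) * x) * x'"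
      by (simp only: of_nat_mult const_mult mult.assoc)
    then show ?thesis
      by (simp only: const_commute[of "of_nat b"] mult.assoc)
  qed
  show ?thesis
    unfolding binom_sum_eq z_binom_def
    by (subst sum_binom_Cons[where h = "\<lambda>c rs. const (of_nat c) * zprod rs"])
      (simp only: zprod_Cons eq sum_product)
qed

definition admissible :: "(nat \<Rightarrow> nat) \<Rightarrow> nat list set" where
  "admissible low = {ks. \<forall>j<length ks. low j \<le> ks ! j}"

lemma admissible_Nil [simp]: "[] \<in> admissible low"
  by (simp add: admissible_def)

lemma admissible_Cons: "k # ks \<in> admissible low \<longleftrightarrow> low 0 \<le> k \<and> ks \<in> admissible (low \<circ> Suc)"
  by (auto simp: admissible_def nth_Cons split: nat.splits)

text \<open>Unitriangularity: \<open>z_binom l k\<close> is \<open>z k\<close> plus a combination of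
  \<open>z r\<close> with \<open>l \<le> r < k\<close>.\<close>

lemma z_in_subspace:
  assumes "ncp.subspace S" "\<And>r. l \<le> r \<Longrightarrow> z_binom l r \<in> S" "l \<le> k"
  shows "z k \<in> S"
  using assms(3)
proof (induction k rule: less_induct)
  case (less k)
  have "z_binom l k = (\<Sum>r=l..<k. const (of_nat ((k - l) choose (r - l))) * z r) + z k"
    using less.prems by (simp add: z_binom_def sum.last_plus)
  then have "z k = z_binom l k - (\<Sum>r=l..<k. const (of_nat ((k - l) choose (r - l))) * z r)"
    by simp
  also have "\<dots> \<in> S"
    using less assms(2) by (intro ncp.subspace_diff ncp.subspace_sum ncp.subspace_scale assms(1)) auto
  finally show ?case .
qed

lemma subspace_left: "ncp.subspace S \<Longrightarrow> ncp.subspace {x. a * x \<in> S}"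
  unfolding ncp.subspace_def
proof (safe, goal_cases)
  case (3 c x)
  have "a * (const c * x) = const c * (a * x)"
    by (simp only: const_commute[of c a] flip: mult.assoc)
  with 3 show ?case by simp
qed (auto simp: distrib_left)

lemma subspace_right: "ncp.subspace S \<Longrightarrow> ncp.subspace {x. x * a \<in> S}"
  unfolding ncp.subspace_def by (auto simp: distrib_right mult.assoc)

text \<open>Triangularity is applied one factor at a time, first in the tail and then in the head.
  \<open>S\<close> and \<open>low\<close> vary in the induction because the tail is treated in a
  preimage of \<open>S\<close> and with shifted bounds.\<close>

lemma zprod_in_subspace:
  assumes "ncp.subspace S" "\<And>rs. rs \<in> admissible low \<Longrightarrow> binom_sum low rs \<in> S" "ks \<in> admissible low"
  shows "zprod ks \<in> S"
  using assms
proof (induction ks arbitrary: low S)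
  case Nil
  then show ?case
    using Nil(2)[of "[]"] by (simp add: binom_sum_Nil)
next
  case (Cons k ks)
  have "z_binom (low 0) r * zprod ks \<in> S" if "low 0 \<le> r" for r
  proof -
    have "zprod ks \<in> {x. z_binom (low 0) r * x \<in> S}"
    proof (rule Cons.IH[of _ "low \<circ> Suc"])
      fix rs assume "rs \<in> admissible (low \<circ> Suc)"
      then show "binom_sum (low \<circ> Suc) rs \<in> {x. z_binom (low 0) r * x \<in> S}"
        using Cons.prems(2)[of "r # rs"] that by (simp add: admissible_Cons binom_sum_Cons)
    qed (use Cons.prems in \<open>simp_all only: admissible_Cons subspace_left\<close>)
    then show ?thesis by simp
  qed
  then have "z k \<in> {x. x * zprod ks \<in> S}"
    using Cons.prems by (intro z_in_subspace[of _ "low 0"] subspace_right) (auto simp: admissible_Cons)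
  then show ?case
    by (simp add: zprod_Cons)
qed

definition binom_map :: "(nat \<Rightarrow> nat) \<Rightarrow> ncpoly \<Rightarrow> ncpoly" where
  "binom_map low = z_ext const (binom_sum low)"

lemma binom_map_add: "binom_map low (a + b) = binom_map low a + binom_map low b"
  by (simp add: binom_map_def z_ext_def lin_ext_add const_add)

lemma binom_map_scale: "binom_map low (const c * a) = const c * binom_map low a"
  by (simp add: binom_map_def z_ext_def lin_ext_const_mult const_mult)

lemma binom_map_zprod: "binom_map low (zprod ks) = binom_sum low ks"
  by (simp add: binom_map_def z_ext_zprod)

lemma binom_map_0: "binom_map low 0 = 0"
  using binom_map_scale[of low 0 0] by simp

abbreviation zspan :: "(nat \<Rightarrow> nat) \<Rightarrow> ncpoly set" where
  "zspan low \<equiv> ncp.span (zprod ` admissible low)"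

text \<open>Lowering exponents no further than \<open>low\<close> preserves admissibility.
  Conversely the image is a subspace containing every admissible \<open>binom_sum\<close>, hence
  every admissible \<open>zprod\<close> by triangularity.\<close>

lemma binom_map_zspan: "binom_map low ` zspan low = zspan low"
proof
  have "binom_map low a \<in> zspan low" if "a \<in> zspan low" for a
    using that
  proof (induction rule: ncp.span_induct_alt)
    case (step c x a)
    then obtain ks where ks: "x = zprod ks" "ks \<in> admissible low"
      by auto
    have "binom_sum low ks \<in> zspan low"
      unfolding binom_sum_eq
      by (intro ncp.span_sum ncp.span_scale ncp.span_base)
        (auto simp: binom_range_def admissible_def)
    with step show ?case
      by (auto simp: binom_map_add binom_map_scale binom_map_zprod ks intro!: ncp.span_add ncp.span_scale)
  qed (simp add: binom_map_0 ncp.span_zero)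
  then show "binom_map low ` zspan low \<subseteq> zspan low"
    by blast
  have sub: "ncp.subspace (binom_map low ` zspan low)"
    unfolding ncp.subspace_def
  proof (intro conjI ballI allI)
    show "0 \<in> binom_map low ` zspan low"
      using imageI[OF ncp.span_zero, of "binom_map low"] by (simp add: binom_map_0)
  qed (auto simp flip: binom_map_add binom_map_scale intro!: imageI ncp.span_add ncp.span_scale)
  show "zspan low \<subseteq> binom_map low ` zspan low"
  proof (rule ncp.span_minimal[OF _ sub])
    have *: "binom_sum low rs \<in> binom_map low ` zspan low" if "rs \<in> admissible low" for rs
      using that by (auto simp flip: binom_map_zprod intro!: imageI ncp.span_base)
    show "zprod ` admissible low \<subseteq> binom_map low ` zspan low"
      by (rule image_subsetI, rule zprod_in_subspace[OF sub *])
  qed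
qed

section \<open>Reduction to the model sums\<close>

text \<open>The parameter \<open>e\<close> is \<open>0\<close> for \<open>V\<close> and \<open>1\<close> for \<open>U\<close>. Reading \<open>LY\<close> as \<open>p ^ e * y\<close>, the word
  of \<open>z k\<^sub>1 \<cdots> z k\<^sub>n\<close> is \<open>zword [k\<^sub>1 - e, \<dots>, k\<^sub>n - e]\<close>, so both dualities act on words in the
  same way.\<close>

definition shift_low :: "nat \<Rightarrow> nat \<Rightarrow> nat" where
  "shift_low e j = (if j = 0 then Suc e else e)"

lemma V_low_eq: "V_low = shift_low 0" and U_low_eq: "U_low = shift_low 1"
  by (auto simp: V_low_def U_low_def shift_low_def)

lemma shift_low_Suc [simp]: "shift_low e \<circ> Suc = (\<lambda>_. e)"
  by (auto simp: shift_low_def)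

lemma admissible_const: "ks \<in> admissible (\<lambda>_. e) \<longleftrightarrow> (\<forall>k\<in>set ks. e \<le> k)"
  by (auto simp: admissible_def all_set_conv_all_nth)

lemma admissible_low_Cons: "k # ks \<in> admissible (shift_low e) \<longleftrightarrow> e < k \<and> (\<forall>k\<in>set ks. e \<le> k)"
  by (simp add: admissible_Cons admissible_const) (simp add: shift_low_def Suc_le_eq)

text \<open>Coefficient \<open>N\<close> only collects \<open>m \<le> N\<close>. For a word starting
  with \<open>LP\<close> nothing is lost, as its weight at \<open>m\<close> is a multiple of
  \<open>fps_X ^ m\<close>.\<close>

definition series :: "(nat \<Rightarrow> rat fps) \<Rightarrow> letter list \<Rightarrow> rat fps" where
  "series c u = Abs_fps (\<lambda>N. \<Sum>m\<le>N. fps_nth (weight c u m) N)"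

lemma series_nth: "fps_nth (series c u) N = (\<Sum>m\<le>N. fps_nth (weight c u m) N)"
  by (simp add: series_def)

text \<open>The Schlesinger-Zudilin model for \<open>e = 0\<close> and the Bradley-Zhao model for
  \<open>e = 1\<close>. The subtraction is exact on admissible lists, whose exponents are all at
  least \<open>e\<close>.\<close>

definition zeta_model :: "nat \<Rightarrow> ncpoly \<Rightarrow> rat fps" where
  "zeta_model e = z_ext fps_const (\<lambda>ks. series (\<lambda>n. geom n ^ e) (zword (map (\<lambda>k. k - e) ks)))"

lemma zeta_model_add: "zeta_model e (a + b) = zeta_model e a + zeta_model e b"
  by (simp add: zeta_model_def z_ext_def lin_ext_add flip: fps_const_add)

lemma zeta_model_scale: "zeta_model e (const c * a) = fps_const c * zeta_model e a"
  by (simp add: zeta_model_def z_ext_def lin_ext_const_mult flip: fps_const_mult)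

lemma zeta_model_zprod: "zeta_model e (zprod ks) = series (\<lambda>n. geom n ^ e) (zword (map (\<lambda>k. k - e) ks))"
  by (simp add: zeta_model_def z_ext_zprod)

lemma zeta_model_0: "zeta_model e 0 = 0"
  using zeta_model_scale[of e 0 0] by simp

lemma zeta_model_sum: "zeta_model e (sum f A) = (\<Sum>x\<in>A. zeta_model e (f x))"
  by (induction A rule: infinite_finite_induct) (simp_all add: zeta_model_add zeta_model_0)

lemma zeta_OOZ_0: "zeta_OOZ 0 = 0"
  using zeta_OOZ_scale[of 0 0] by simp

section \<open>Collapse of the binomial sums\<close>

lemma weight_block:
  "weight c (replicate k LP @ LY # u) m = pgeom m ^ k * (c m * (\<Sum>a<m. weight c u a))"
  by (induction k) (simp_all add: mult.assoc)

text \<open>The binomial theorem for \<open>(pgeom m + 1) ^ d\<close>, where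
  \<open>pgeom m + 1 = geom m\<close> requires \<open>m > 0\<close>.\<close>

lemma sum_choose_pgeom:
  assumes "m > 0"
  shows "(\<Sum>r=e + b..e + b + d. of_nat (d choose (r - (e + b))) * pgeom m ^ (r - e)) = pgeom m ^ b * geom m ^ d"
proof -
  have "(\<Sum>r=e + b..e + b + d. of_nat (d choose (r - (e + b))) * pgeom m ^ (r - e))
      = (\<Sum>i\<le>d. of_nat (d choose i) * pgeom m ^ (b + i))"
    by (subst sum.atLeastAtMost_shift_0) (simp_all add: atMost_atLeast0 add.assoc)
  also have "\<dots> = pgeom m ^ b * (pgeom m + 1) ^ d"
    by (simp add: binomial_ring power_add sum_distrib_left mult_ac)
  finally show ?thesis
    by (simp add: geom_eq[OF assms])
qed

text \<open>The contribution of the outermost index \<open>m\<close> to the model value of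
  \<open>binom_sum l ks\<close>.\<close>

definition binom_weight :: "nat \<Rightarrow> (nat \<Rightarrow> nat) \<Rightarrow> nat list \<Rightarrow> nat \<Rightarrow> rat fps" where
  "binom_weight e l ks m = (\<Sum>rs\<in>binom_range l ks. of_nat (binom_coeff l ks rs) *
     weight (\<lambda>n. geom n ^ e) (zword (map (\<lambda>r. r - e) rs)) m)"

text \<open>The sum over the first exponent collapses by \<open>sum_choose_pgeom\<close>, and the
  other sums pass inside the sum over \<open>a\<close>. Here \<open>b\<close> is the excess of the
  lower bound over \<open>e\<close>: 1 for the first block and 0 for later ones. At
  \<open>m = 0\<close> the inner sums are empty.\<close>

lemma binom_weight_Cons:
  assumes "l 0 = e + b"
  shows "binom_weight e l ((e + b + d) # ks) m
       = pgeom m ^ b * geom m ^ (d + e) * (\<Sum>a<m. binom_weight e (l \<circ> Suc) ks a)"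
proof (cases "m = 0")
  case True
  then show ?thesis
    by (simp add: binom_weight_def zword_Cons weight_block binom_range_Cons sum.reindex inj_on_def case_prod_beta)
next
  case False
  define f where "f rs = weight (\<lambda>n. geom n ^ e) (zword (map (\<lambda>r. r - e) rs))" for rs
  define B where "B rs = (of_nat (binom_coeff (l \<circ> Suc) ks rs) :: rat fps)" for rs
  define R where "R = binom_range (l \<circ> Suc) ks"
  have f_Cons: "f (r # rs) m = pgeom m ^ (r - e) * (geom m ^ e * (\<Sum>a<m. f rs a))" for r rs
    by (simp add: f_def zword_Cons weight_block)
  have "binom_weight e l ((e + b + d) # ks) m
      = (\<Sum>r=e + b..e + b + d. \<Sum>rs\<in>R. of_nat (d choose (r - (e + b))) * B rs * f (r # rs) m)"
    unfolding binom_weight_def f_def[symmetric] B_def R_def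
    by (subst sum_binom_Cons[where h = "\<lambda>c rs. of_nat c * f rs m"]) (simp add: assms)
  also have "\<dots> = (\<Sum>r=e + b..e + b + d. of_nat (d choose (r - (e + b))) * pgeom m ^ (r - e))
      * (\<Sum>rs\<in>R. B rs * (geom m ^ e * (\<Sum>a<m. f rs a)))"
    unfolding f_Cons sum_product by (simp only: mult_ac)
  also have "(\<Sum>rs\<in>R. B rs * (geom m ^ e * (\<Sum>a<m. f rs a))) = geom m ^ e * (\<Sum>a<m. \<Sum>rs\<in>R. B rs * f rs a)"
    unfolding sum_distrib_left by (subst sum.swap) (simp only: mult_ac)
  finally show ?thesis
    unfolding sum_choose_pgeom[OF False[unfolded neq0_conv]]
    by (simp add: binom_weight_def B_def R_def f_def power_add mult.assoc)
qed

lemma binom_weight_const: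
  assumes "\<forall>k\<in>set ks. e \<le> k"
  shows "binom_weight e (\<lambda>_. e) ks m = ooz_weight ks m"
  using assms
proof (induction ks arbitrary: m)
  case Nil
  then show ?case
    by (simp add: binom_weight_def binom_range_Nil binom_coeff_def)
next
  case (Cons k ks)
  then obtain d where k: "k = e + 0 + d"
    by (auto simp: le_iff_add)
  have "binom_weight e (\<lambda>_. e) (k # ks) m
      = pgeom m ^ 0 * geom m ^ (d + e) * (\<Sum>a<m. binom_weight e ((\<lambda>_. e) \<circ> Suc) ks a)"
    unfolding k by (rule binom_weight_Cons) simp
  with Cons show ?case
    by (simp add: k comp_def add.commute)
qed

text \<open>The excess 1 of the first lower bound leaves one factor
  \<open>pgeom m = fps_X ^ m * geom m\<close>; this is the source of the numerator
  \<open>q^m\<close>.\<close>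

lemma binom_weight_low:
  assumes "k # ks \<in> admissible (shift_low e)"
  shows "binom_weight e (shift_low e) (k # ks) m = fps_X ^ m * ooz_weight (k # ks) m"
proof -
  obtain d where k: "k = e + 1 + d"
    using assms by (auto simp: admissible_low_Cons less_iff_Suc_add)
  have "binom_weight e (shift_low e) (k # ks) m
      = pgeom m ^ 1 * geom m ^ (d + e) * (\<Sum>a<m. binom_weight e (shift_low e \<circ> Suc) ks a)"
    unfolding k by (rule binom_weight_Cons) (simp add: shift_low_def)
  with assms show ?thesis
    by (simp add: k admissible_low_Cons binom_weight_const pgeom_def power_add mult_ac)
qed

text \<open>In each coefficient the finite sums over \<open>rs\<close> and \<open>m\<close> are
  interchanged, which leaves an identity for each single \<open>m\<close>.\<close>

lemma zeta_model_binom_map: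
  assumes "a \<in> zspan (shift_low e)"
  shows "zeta_model e (binom_map (shift_low e) a) = zeta_OOZ a"
  using assms
proof (induction rule: ncp.span_induct_alt)
  case base
  show ?case
    by (simp add: binom_map_0 zeta_model_0 zeta_OOZ_0)
next
  case (step c x a)
  then obtain ks where ks: "x = zprod ks" "ks \<in> admissible (shift_low e)"
    by auto
  have nth: "fps_nth (zeta_model e (binom_map (shift_low e) x)) N = (\<Sum>m\<le>N. fps_nth (binom_weight e (shift_low e) ks m) N)" for N
  proof -
    have "fps_nth (zeta_model e (binom_map (shift_low e) x)) N = (\<Sum>rs\<in>binom_range (shift_low e) ks. of_nat (binom_coeff (shift_low e) ks rs) *
       (\<Sum>m\<le>N. fps_nth (weight (\<lambda>n. geom n ^ e) (zword (map (\<lambda>r. r - e) rs)) m) N))"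
      by (simp add: ks binom_map_zprod binom_sum_eq zeta_model_sum zeta_model_scale zeta_model_zprod fps_sum_nth series_nth)
    also have "\<dots> = (\<Sum>m\<le>N. \<Sum>rs\<in>binom_range (shift_low e) ks. of_nat (binom_coeff (shift_low e) ks rs) *
       fps_nth (weight (\<lambda>n. geom n ^ e) (zword (map (\<lambda>r. r - e) rs)) m) N)"
      unfolding sum_distrib_left by (rule sum.swap)
    finally show ?thesis
      by (simp add: binom_weight_def fps_sum_nth flip: fps_of_nat)
  qed
  have "zeta_model e (binom_map (shift_low e) x) = zeta_OOZ x"
  proof (cases ks)
    case Nil
    \<comment> \<open>For the empty list the value is 1 by definition, and only \<open>m = 0\<close>
      contributes to the model.\<close>
    have "fps_nth (zeta_model e (binom_map (shift_low e) x)) N = fps_nth 1 N" for N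
      unfolding nth by (subst sum.remove[of _ 0])
        (auto simp: Nil binom_weight_def binom_range_Nil binom_coeff_def intro!: sum.neutral)
    then show ?thesis
      unfolding ks(1) zeta_OOZ_zprod by (simp add: zeta_OOZ_z_def Nil fps_eq_iff)
  next
    case (Cons k ks')
    show ?thesis
    proof (rule fps_ext)
      fix N
      have "fps_nth (zeta_model e (binom_map (shift_low e) x)) N = (\<Sum>m\<le>N. fps_nth (fps_X ^ m * ooz_weight ks m) N)"
        using ks(2) by (simp only: nth Cons binom_weight_low)
      also have "\<dots> = fps_nth (zeta_OOZ x) N"
        unfolding ks(1) zeta_OOZ_zprod by (simp add: zeta_OOZ_z_nth Cons)
      finally show "fps_nth (zeta_model e (binom_map (shift_low e) x)) N = fps_nth (zeta_OOZ x) N" .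
    qed
  qed
  with step show ?case
    by (simp add: binom_map_add binom_map_scale zeta_model_add zeta_model_scale zeta_OOZ_add zeta_OOZ_scale)
qed

section \<open>Duality\<close>

definition dual_word :: "letter list \<Rightarrow> letter list" where
  "dual_word u = rev (map swap_letter u)"

text \<open>Nonemptiness is carried through the induction because prepending \<open>LP\<close>
  raises the first exponent.\<close>

lemma zword_ends_LY: "\<exists>ks. ks \<noteq> [] \<and> zword ks = u @ [LY]"
proof (induction u)
  case Nil
  show ?case
    by (intro exI[of _ "[0]"]) (simp add: zword_Cons)
next
  case (Cons l u)
  then obtain k ks where "zword (k # ks) = u @ [LY]"
    by (metis neq_Nil_conv)
  then show ?case
    by (cases l; intro exI[of _ "if l = LP then Suc k # ks else 0 # k # ks"]) (simp_all add: zword_Cons)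
qed

text \<open>The word basis of \<open>H0\<close>. It is stable under \<open>dual_word\<close>:
  reversal exchanges the two ends and the swap restores \<open>LP\<close> in front and
  \<open>LY\<close> at the end.\<close>

definition bounded_word :: "letter list \<Rightarrow> bool" where
  "bounded_word u \<longleftrightarrow> u = [] \<or> (\<exists>u'. u = LP # u' @ [LY])"

lemma bounded_dual_word: "bounded_word u \<Longrightarrow> bounded_word (dual_word u)"
  unfolding bounded_word_def dual_word_def
  by (elim disjE exE; hypsubst) simp_all

lemma bounded_zword: "bounded_word (zword (k # ks)) \<longleftrightarrow> 0 < k"
proof
  show "bounded_word (zword (k # ks)) \<Longrightarrow> 0 < k"
    by (cases k) (auto simp: bounded_word_def zword_Cons)
next
  have "\<exists>u'. LY # zword ks = u' @ [LY]" for ks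
    by (induction ks rule: rev_induct) (auto simp: zword_def)
  moreover assume "0 < k"
  ultimately show "bounded_word (zword (k # ks))"
    by (cases k) (auto simp: bounded_word_def zword_Cons, metis append.assoc)
qed

lemma bounded_word_zword: "bounded_word u \<Longrightarrow> \<exists>ls. u = zword ls"
  by (metis append_Cons bounded_word_def zword_Nil zword_ends_LY)

text \<open>Once \<open>e\<close> is subtracted, admissibility for \<open>U\<close> and for
  \<open>V\<close> is the same condition on words.\<close>

lemma admissible_low:
  "map ((+) e) ls \<in> admissible (shift_low e) \<longleftrightarrow> bounded_word (zword ls)"
  by (cases ls) (simp_all add: admissible_low_Cons bounded_zword, simp add: bounded_word_def)

lemma map_plus_0: "map ((+) (0::nat)) ks = ks"
  by (simp add: map_idI)

lemma admissible_lowE: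
  assumes "ks \<in> admissible (shift_low e)"
  obtains ls where "ks = map ((+) e) ls" "bounded_word (zword ls)"
proof
  have "\<forall>k\<in>set ks. e \<le> k"
    using assms by (cases ks) (auto simp: admissible_low_Cons)
  then show "ks = map ((+) e) (map (\<lambda>k. k - e) ks)"
    by (simp add: map_idI)
  with assms show "bounded_word (zword (map (\<lambda>k. k - e) ks))"
    by (metis admissible_low)
qed

lemma series_dual_word:
  assumes "connector C c" "bounded_word u"
  shows "series c (dual_word u) = series c u"
  using assms(2) connector.duality[OF assms(1), of u]
  by (auto simp: bounded_word_def dual_word_def fps_eq_iff series_nth)

text \<open>The common argument for both dualities: a linear \<open>T\<close> acting on coded words
  by \<open>dual_word\<close> preserves \<open>zspan (shift_low e)\<close> and, by the connector,
  the model value there.\<close>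

lemma zeta_OOZ_duality:
  assumes conn: "connector C (\<lambda>n. geom n ^ e)"
    and add: "\<And>a b. T (a + b) = T a + T b" and scale: "\<And>c a. T (const c * a) = const c * T a"
    and T: "\<And>ls ls'. bounded_word (zword ls) \<Longrightarrow> zword ls' = dual_word (zword ls) \<Longrightarrow>
      T (zprod (map ((+) e) ls)) = zprod (map ((+) e) ls')"
    and a: "a \<in> zspan (shift_low e)"
  shows "zeta_OOZ a = zeta_OOZ (inv_into (zspan (shift_low e)) (binom_map (shift_low e)) (T (binom_map (shift_low e) a)))"
proof -
  have T_0: "T 0 = 0"
    using scale[of 0 0] by simp
  have T_Z: "T b \<in> zspan (shift_low e) \<and> zeta_model e (T b) = zeta_model e b" if "b \<in> zspan (shift_low e)" for b
    using that
  proof (induction rule: ncp.span_induct_alt)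
    case (step c x b)
    then obtain ls where ls: "x = zprod (map ((+) e) ls)" "bounded_word (zword ls)"
      by (auto elim: admissible_lowE)
    then obtain ls' where ls': "zword ls' = dual_word (zword ls)"
      by (metis bounded_dual_word bounded_word_zword)
    then have "map ((+) e) ls' \<in> admissible (shift_low e)"
      using ls by (simp add: admissible_low bounded_dual_word)
    moreover have "zeta_model e (T x) = zeta_model e x"
      using ls ls' T[OF ls(2) ls'] by (simp add: zeta_model_zprod comp_def series_dual_word[OF conn])
    ultimately show ?case
      using step T[OF ls(2) ls'] ls(1)
      by (auto simp: add scale zeta_model_add zeta_model_scale intro!: ncp.span_add ncp.span_scale intro: ncp.span_base)
  qed (simp add: T_0 zeta_model_0 ncp.span_zero)
  let ?b = "T (binom_map (shift_low e) a)"
  have "binom_map (shift_low e) a \<in> zspan (shift_low e)"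
    using a binom_map_zspan by blast
  then have b: "?b \<in> binom_map (shift_low e) ` zspan (shift_low e)" and "zeta_model e ?b = zeta_OOZ a"
    using T_Z a by (simp_all add: binom_map_zspan zeta_model_binom_map)
  \<comment> \<open>The chosen preimage of \<open>?b\<close> is mapped back to \<open>?b\<close>, so
    its value is \<open>zeta_model e ?b\<close>.\<close>
  then show ?thesis
    using zeta_model_binom_map[OF inv_into_into[OF b]] by (simp add: f_inv_into_f[OF b])
qed

section \<open>The spaces H0 and h0\<close>

lemma subspace_const_plus:
  assumes "ncp.subspace A"
  shows "ncp.subspace {const c + u * a * v | c a. a \<in> A}" (is "ncp.subspace ?S")
  unfolding ncp.subspace_def
proof (intro conjI ballI allI)
  have "0 = const 0 + u * 0 * v"
    by simp
  then show "0 \<in> ?S"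
    using ncp.subspace_0[OF assms] by blast
next
  fix a b assume "a \<in> ?S" "b \<in> ?S"
  then obtain c a' d b' where "a = const c + u * a' * v" "b = const d + u * b' * v"
      and A: "a' \<in> A" "b' \<in> A"
    by auto
  then have "a + b = const (c + d) + u * (a' + b') * v"
    by (simp add: const_add algebra_simps)
  then show "a + b \<in> ?S"
    using ncp.subspace_add[OF assms A] by blast
next
  fix r a assume "a \<in> ?S"
  then obtain c a' where a': "a = const c + u * a' * v" "a' \<in> A"
    by auto
  have "const r * (u * a' * v) = u * (const r * a') * v"
    by (simp only: const_commute[of r u] flip: mult.assoc)
  then have "const r * a = const (r * c) + u * (const r * a') * v"
    by (simp only: a' const_mult distrib_left)
  then show "const r * a \<in> ?S"
    using ncp.subspace_scale[OF assms a'(2)] by blast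
qed

text \<open>A word starting with \<open>LP\<close> and ending in \<open>LY\<close> is a
  \<open>zword\<close> with positive first exponent; the rest is linearity.\<close>

lemma H0_eq: "H0 = zspan V_low"
proof
  have mon: "p * monomial u * y \<in> zspan V_low" for u
  proof -
    have "bounded_word (LP # u @ [LY])"
      by (simp add: bounded_word_def)
    then obtain ls where ls: "LP # u @ [LY] = zword ls"
      using bounded_word_zword by blast
    then have "ls \<in> admissible (shift_low 0)"
      using admissible_low[of 0 ls] \<open>bounded_word (LP # u @ [LY])\<close> by (simp add: map_plus_0 flip: ls)
    moreover have "p * monomial u * y = zprod ls"
      unfolding p_def y_def zprod_monomial ls[symmetric] by (simp flip: monomial_append)
    ultimately show ?thesis
      by (auto simp: V_low_eq intro: ncp.span_base)
  qed
  have one: "1 \<in> zspan V_low"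
    using ncp.span_base[of 1 "zprod ` admissible V_low"] image_eqI[of 1 zprod "[]"] by simp
  have "p * a * y \<in> zspan V_low" for a
  proof -
    \<comment> \<open>The condition is linear in \<open>a\<close>, so it passes from monomials to
      all elements.\<close>
    have "ncp.subspace {a. p * a * y \<in> zspan V_low}"
      using subspace_left[OF subspace_right[OF ncp.subspace_span], of p y] by (simp add: mult.assoc)
    then have "(\<Sum>u\<in>Poly_Mapping.keys a. const (Poly_Mapping.lookup a u) * monomial (letters u))
        \<in> {a. p * a * y \<in> zspan V_low}"
      by (intro ncp.subspace_sum ncp.subspace_scale) (simp_all add: mon)
    then show ?thesis
      by (simp flip: ncpoly_expand)
  qed
  then show "H0 \<subseteq> zspan V_low"
    using ncp.span_scale[OF one] by (auto simp: H0_def intro!: ncp.span_add)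
  show "zspan V_low \<subseteq> H0"
  proof (rule ncp.span_minimal)
    have H0: "H0 = {const c + p * a * y | c a. a \<in> UNIV}"
      by (simp add: H0_def)
    show "ncp.subspace H0"
      by (subst H0) (rule subspace_const_plus[OF ncp.subspace_UNIV])
    show "zprod ` admissible V_low \<subseteq> H0"
    proof (rule image_subsetI)
      fix ks assume "ks \<in> admissible V_low"
      then have "bounded_word (zword ks)"
        using admissible_low[of 0 ks] by (simp add: V_low_eq map_plus_0)
      then consider "zword ks = []" | u where "zword ks = [LP] @ u @ [LY]"
        by (auto simp: bounded_word_def)
      then show "zprod ks \<in> H0"
      proof cases
        case 1
        then show ?thesis
          unfolding H0_def zprod_monomial by (intro CollectI exI[of _ 1] exI[of _ 0]) simp
      next
        case 2
        then have "zprod ks = const 0 + p * monomial u * y"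
          by (simp add: zprod_monomial p_def y_def monomial_append mult.assoc del: append_Cons)
        then show ?thesis
          unfolding H0_def by blast
      qed
    qed
  qed
qed

section \<open>The space \<open>h0\<close> inside the subalgebra \<open>hh\<close>\<close>

lemma x0_zprod: "x0 * zprod (k # ks) = zprod (Suc k # ks)"
  by (simp add: x0_def zprod_Cons z_def mult.assoc)

lemma x0_power_hh: "x0 ^ k \<in> hh"
  using hh.const[of 1] by (induction k) (auto intro: hh.intros)

lemma zprod_hh:
  assumes "ks \<noteq> []" "\<forall>k\<in>set ks. 0 < k"
  shows "\<exists>a\<in>hh. zprod ks = a * x1"
  using assms
proof (induction ks)
  case (Cons k ks)
  then obtain j where "k = Suc j"
    by (cases k) auto
  then have z: "z k = x0 ^ j * x1"
    by (simp add: z_def x0_def x1_def power_commutes flip: mult.assoc)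
  show ?case
  proof (cases "ks = []")
    case True
    then show ?thesis
      by (auto simp: zprod_Cons z x0_power_hh)
  next
    case False
    then obtain a where "a \<in> hh" "zprod ks = a * x1"
      using Cons by auto
    then show ?thesis
      by (intro bexI[of _ "x0 ^ j * x1 * a"])
        (auto simp: zprod_Cons z mult.assoc intro!: hh.intros x0_power_hh)
  qed
qed simp

text \<open>This is \<open>hh * x1\<close>, written through a spanning set. The lists are nonempty
  because \<open>x0\<close> acts by raising the first exponent; \<open>x1\<close> prepends the
  exponent 1.\<close>

definition hh_x1 :: "ncpoly set" where
  "hh_x1 = ncp.span (zprod ` {ks. ks \<noteq> [] \<and> (\<forall>k\<in>set ks. 0 < k)})"

lemma subspace_hh_x1: "ncp.subspace hh_x1"
  by (simp add: hh_x1_def)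

text \<open>Closure under left multiplication passes through sums and products, so the generators
  decide; \<open>b\<close> stays arbitrary for the product case.\<close>

lemma mult_hh_x1:
  assumes "a \<in> hh" "b \<in> hh_x1"
  shows "a * b \<in> hh_x1"
  using assms
proof (induction a arbitrary: b rule: hh.induct)
  case (const c)
  then show ?case
    by (simp add: subspace_hh_x1 ncp.subspace_scale)
next
  case x0
  have "zprod ks \<in> {b. x0 * b \<in> hh_x1}" if "ks \<noteq> []" "\<forall>k\<in>set ks. 0 < k" for ks
    using that by (cases ks) (auto simp: x0_zprod hh_x1_def intro!: ncp.span_base)
  then have "hh_x1 \<subseteq> {b. x0 * b \<in> hh_x1}"
    by (subst (1) hh_x1_def) (intro ncp.span_minimal subspace_left subspace_hh_x1, auto)
  with x0 show ?case
    by blast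
next
  case x1
  have "zprod ks \<in> {b. x1 * b \<in> hh_x1}" if "\<forall>k\<in>set ks. 0 < k" for ks
  proof -
    have "x1 * zprod ks = zprod (1 # ks)"
      by (simp add: x1_def zprod_Cons z_def)
    with that show ?thesis
      by (auto simp: hh_x1_def intro!: ncp.span_base)
  qed
  then have "hh_x1 \<subseteq> {b. x1 * b \<in> hh_x1}"
    by (subst (1) hh_x1_def) (intro ncp.span_minimal subspace_left subspace_hh_x1, auto)
  with x1 show ?case
    by blast
next
  case (add a1 a2)
  then show ?case
    by (simp add: distrib_right subspace_hh_x1 ncp.subspace_add)
next
  case (mult a1 a2)
  then show ?case
    by (simp add: mult.assoc)
qed

text \<open>Multiplication by \<open>x0\<close> lifts the first exponent from at least 1 to at least
  2, so \<open>x0 * hh_x1\<close> supplies the nonconstant part.\<close>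

lemma h0_eq: "h0 = zspan U_low"
proof
  have one: "1 \<in> zspan U_low"
    using ncp.span_base[of 1 "zprod ` admissible U_low"] image_eqI[of 1 zprod "[]"] by simp
  have x1: "x1 \<in> hh_x1"
  proof -
    have "x1 = zprod [1]"
      by (simp add: x1_def zprod_Cons z_def)
    then show ?thesis
      by (auto simp: hh_x1_def intro!: ncp.span_base)
  qed
  have "zprod ks \<in> {b. x0 * b \<in> zspan U_low}" if "ks \<noteq> []" "\<forall>k\<in>set ks. 0 < k" for ks
    using that by (cases ks)
      (auto simp: x0_zprod U_low_eq admissible_low_Cons Suc_le_eq intro!: ncp.span_base)
  then have "hh_x1 \<subseteq> {b. x0 * b \<in> zspan U_low}"
    by (subst hh_x1_def) (intro ncp.span_minimal subspace_left ncp.subspace_span, auto)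
  then have "x0 * a * x1 \<in> zspan U_low" if "a \<in> hh" for a
    using mult_hh_x1[OF that x1] by (auto simp: mult.assoc)
  then show "h0 \<subseteq> zspan U_low"
    using ncp.span_scale[OF one] by (auto simp: h0_def intro!: ncp.span_add)
  show "zspan U_low \<subseteq> h0"
  proof (rule ncp.span_minimal)
    have "ncp.subspace hh"
      using hh.const[of 0] by (auto simp: ncp.subspace_def intro: hh.intros)
    then show "ncp.subspace h0"
      unfolding h0_def by (rule subspace_const_plus)
    show "zprod ` admissible U_low \<subseteq> h0"
    proof (rule image_subsetI)
      fix ks assume ks: "ks \<in> admissible U_low"
      show "zprod ks \<in> h0"
      proof (cases ks)
        case Nil
        have "zprod ks = const 1 + x0 * const 0 * x1"
          by (simp add: Nil)
        then show ?thesis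
          unfolding h0_def using hh.const[of 0] by blast
      next
        case (Cons k ks')
        then obtain j where j: "k = Suc j" "0 < j" "\<forall>k\<in>set ks'. 0 < k"
          using ks by (cases k) (auto simp: U_low_eq admissible_low_Cons Suc_le_eq)
        then obtain a where "a \<in> hh" "zprod (j # ks') = a * x1"
          using zprod_hh[of "j # ks'"] by auto
        then have "zprod ks = const 0 + x0 * a * x1"
          by (simp add: Cons j mult.assoc flip: x0_zprod)
        then show ?thesis
          unfolding h0_def using \<open>a \<in> hh\<close> by blast
      qed
    qed
  qed
qed

section \<open>Words in \<open>x0\<close> and \<open>x1\<close>, coded by \<open>LP\<close> and
  \<open>LY\<close>\<close>

fun expand_x1 :: "letter list \<Rightarrow> letter list" where
  "expand_x1 [] = []"
| "expand_x1 (LP # u) = LP # expand_x1 u"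
| "expand_x1 (LY # u) = LP # LY # expand_x1 u"

lemma expand_x1_append: "expand_x1 (u @ v) = expand_x1 u @ expand_x1 v"
  by (induction u rule: expand_x1.induct) simp_all

lemma expand_x1_zword: "expand_x1 (zword ls) = zword (map Suc ls)"
proof (induction ls)
  case (Cons l ls)
  have "expand_x1 (replicate l LP @ LY # u) = replicate (Suc l) LP @ LY # expand_x1 u" for u
    by (induction l) simp_all
  with Cons show ?case
    by (simp add: zword_Cons)
qed simp

text \<open>The blocks parsed by \<open>tau_word\<close> are the images of single coded letters, so
  exchanging blocks in reverse order is exchanging letters in reverse order.\<close>

lemma tau_word_expand: "tau_word (expand_x1 u) = expand_x1 (dual_word u)"
proof (induction u)
  case (Cons l u)
  show ?case
  proof (cases l)
    case LP
    \<comment> \<open>\<open>expand_x1 u\<close> never starts with \<open>LY\<close>, so the leading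
      \<open>LP\<close> is parsed as a block \<open>x0\<close>.\<close>
    have "tau_word (LP # expand_x1 u) = tau_word (expand_x1 u) @ [LP, LY]"
      by (cases u rule: expand_x1.cases) simp_all
    with Cons LP show ?thesis
      by (simp add: dual_word_def expand_x1_append)
  next
    case LY
    with Cons show ?thesis
      by (simp add: dual_word_def expand_x1_append)
  qed
qed (simp add: dual_word_def)

lemma tau_tilde_scale: "tau_tilde (const c * a) = const c * tau_tilde a"
  by (simp add: tau_tilde_def lin_ext_const_mult const_mult)

lemma tau_scale: "tau (const c * a) = const c * tau a"
  by (simp add: tau_def lin_ext_const_mult const_mult)

theorem theorem5p9:
  fixes w :: ncpoly
  assumes "w \<in> H0"
  shows "zeta_OOZ w = zeta_OOZ (V_inv (tau_tilde (V w))) \<and>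
         (w \<in> h0 \<longrightarrow> zeta_OOZ w = zeta_OOZ (U_inv (tau (U w))))"
proof (intro conjI impI)
  have V: "V = binom_map (shift_low 0)" and U: "U = binom_map (shift_low 1)"
    by (simp_all add: V_def U_def binom_map_def V_low_eq U_low_eq)
  have "zeta_OOZ w = zeta_OOZ (inv_into (zspan (shift_low 0)) (binom_map (shift_low 0)) (tau_tilde (binom_map (shift_low 0) w)))"
  proof (rule zeta_OOZ_duality[OF _ tau_tilde_add tau_tilde_scale])
    show "connector (\<lambda>m n. fps_X ^ (m * n)) (\<lambda>n. geom n ^ 0)"
      using connector_SZ by simp
    show "tau_tilde (zprod (map ((+) 0) ls)) = zprod (map ((+) 0) ls')"
      if "zword ls' = dual_word (zword ls)" for ls ls'
      using that by (simp add: map_plus_0 zprod_monomial tau_tilde_def lin_ext_monomial dual_word_def)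
  qed (use assms in \<open>simp add: H0_eq V_low_eq\<close>)
  then show "zeta_OOZ w = zeta_OOZ (V_inv (tau_tilde (V w)))"
    by (simp add: V_inv_def V H0_eq V_low_eq)
  assume "w \<in> h0"
  have "zeta_OOZ w = zeta_OOZ (inv_into (zspan (shift_low 1)) (binom_map (shift_low 1)) (tau (binom_map (shift_low 1) w)))"
  proof (rule zeta_OOZ_duality[OF _ tau_add tau_scale])
    show "connector (\<lambda>m n. fps_X ^ (m * n) * qfact m * qfact n * inverse (qfact (m + n))) (\<lambda>n. geom n ^ 1)"
      using connector_BZ by simp
    show "tau (zprod (map ((+) 1) ls)) = zprod (map ((+) 1) ls')"
      if "zword ls' = dual_word (zword ls)" for ls ls'
    proof -
      \<comment> \<open>Adding 1 to every exponent is the substitution \<open>expand_x1\<close>,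
        under which \<open>tau_word\<close> becomes \<open>dual_word\<close>.\<close>
      have "map ((+) 1) = map Suc"
        by (simp add: fun_eq_iff)
      then show ?thesis
        by (simp add: zprod_monomial tau_def lin_ext_monomial tau_word_expand that flip: expand_x1_zword)
    qed
  qed (use \<open>w \<in> h0\<close> in \<open>simp add: h0_eq U_low_eq\<close>)
  then show "zeta_OOZ w = zeta_OOZ (U_inv (tau (U w)))"
    by (simp add: U_inv_def U h0_eq U_low_eq)
qed

end
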